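(* Let $d\geq 4$ be an integer, let $t\ge 0$, and let $z=\frac{d}{2}-t\sqrt{d}$. Consider $$S=\sum_{i=0}^{\lfloor z\rfloor}(-1)^i\binom{d}{i}(z-i)^{d-3}p_{i,d}(z).$$ Let $H$ range over the hyperplanes of $\mathbb{R}^d$ at distance $t$ from the center of $[0,1]^d$. If $S$ is negative, then the $(d-1)$-dimensional volume of $H\cap[0,1]^d$ has a strict local maximum when $H$ is orthogonal to a diagonal of $[0,1]^d$. If $S$ is positive, then the $(d-1)$-dimensional volume of $H\cap[0,1]^d$ has a strict local minimum when $H$ is orthogonal to a diagonal of $[0,1]^d$.
   Context: For integers $d\ge 4$ and $i\ge0$, $p_{i,d}$ is the quadratic function $$p_{i,d}(z)=\frac{i(d-i)}{d-1}-\left(\frac{d}{2}-i\right)\frac{z-i}{d-2}+\frac{2d(z-i)^2}{(d-1)(d-2)}.$$ A sum from $i=0$ to $\lfloor z\rfloor$ is empty (equal to $0$) when $z<0$. A diagonal of $[0,1]^d$ is a line segment between two opposite vertices; its unit direction vectors have all coordinates equal to $\pm 1/\sqrt{d}$. For a unit vector $a\in\mathbb{S}^{d-1}$, let $H_a=\{x\in\mathbb{R}^d: a\cdot x=\tfrac12\sum_{i=1}^d a_i-t\}$; these are exactly the hyperplanes at distance $t$ from the center of $[0,1]^d$. Let $f_t(a)$ be the $(d-1)$-dimensional volume of $H_a\cap[0,1]^d$. Saying that the volume of $H\cap[0,1]^d$ has a strict local maximum (minimum) when $H$ is orthogonal to a segment $D$ means that $f_t:\mathbb{S}^{d-1}\to\mathbb{R}$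 has a strict local maximum (minimum) at every unit vector $a$ parallel to $D$. *)

theory Defs
  imports "HOL-Analysis.Analysis"
begin

definition p_quad :: "nat \<Rightarrow> nat \<Rightarrow> real \<Rightarrow> real" where
  "p_quad i d z =
     real i * (real d - real i) / (real d - 1)
     - (real d / 2 - real i) * ((z - real i) / (real d - 2))
     + 2 * real d * (z - real i)^2 / ((real d - 1) * (real d - 2))"

text \<open>The index set is empty when \<open>z < 0\<close>.\<close>

definition S_sum :: "nat \<Rightarrow> real \<Rightarrow> real" where
  "S_sum d z =
     (\<Sum>i \<in> {i::nat. int i \<le> \<lfloor>z\<rfloor>}.
        (-1)^i * real (d choose i) * (z - real i)^(d - 3) * p_quad i d z)"

definition unit_cube :: "(real^'n) set" where
  "unit_cube = {x. \<forall>i. 0 \<le> x $ i \<and> x $ i \<le> 1}"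

definition cube_vertex :: "real^'n \<Rightarrow> bool" where
  "cube_vertex v \<longleftrightarrow> (\<forall>i. v $ i = 0 \<or> v $ i = 1)"

definition cube_diagonal :: "(real^'n) set \<Rightarrow> bool" where
  "cube_diagonal D \<longleftrightarrow> (\<exists>v. cube_vertex v \<and> D = closed_segment v (1 - v))"

definition directions :: "'a::real_vector set \<Rightarrow> 'a set" where
  "directions X = span {x - y | x y. x \<in> X \<and> y \<in> X}"

text \<open>An orthonormal frame \<open>(p, B)\<close> of a nonempty affine subspace \<open>F\<close>, with origin
  \<open>p\<close>, gives the isometry \<open>c \<mapsto> p + (\<Sum>b\<in>B. c b *\<^sub>R b)\<close> from the space of
  real coordinates indexed by \<open>B\<close> onto \<open>F\<close>.\<close>

definition orthonormal_frame :: "'a::euclidean_space set \<Rightarrow> 'a \<times> 'a set \<Rightarrow> bool" where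
  "orthonormal_frame F = (\<lambda>(p, B).
     p \<in> F \<and> pairwise orthogonal B \<and> (\<forall>b\<in>B. norm b = 1) \<and> span B = directions F)"

text \<open>The volume of \<open>X\<close> inside an affine subspace \<open>F\<close>, in the dimension of \<open>F\<close>: Lebesgue
  measure in orthonormal coordinates of \<open>F\<close>. The choice of frame is immaterial for Borel sets
  because two frames differ by a Euclidean isometry, which preserves Lebesgue measure.\<close>

definition affine_volume :: "'a::euclidean_space set \<Rightarrow> 'a set \<Rightarrow> real" where
  "affine_volume F X =
     (let (p, B) = (SOME fr. orthonormal_frame F fr) in
        measure (\<Pi>\<^sub>M b\<in>B. (lborel :: real measure))
          {c \<in> extensional B. p + (\<Sum>b\<in>B. c b *\<^sub>R b) \<in> X})"

text \<open>As \<open>a\<close> ranges over the unit vectors, these are the hyperplanes at distance \<open>t\<close> from the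
  centre \<open>(1/2, \<dots>, 1/2)\<close> of the cube.\<close>

definition hyperplane_at :: "real \<Rightarrow> real^'n \<Rightarrow> (real^'n) set" where
  "hyperplane_at t a = {x. a \<bullet> x = (1/2) * (\<Sum>i\<in>UNIV. a $ i) - t}"

definition section_volume :: "real \<Rightarrow> real^'n \<Rightarrow> real" where
  "section_volume t a = affine_volume (hyperplane_at t a) (hyperplane_at t a \<inter> unit_cube)"

definition strict_local_max_on :: "'a::topological_space set \<Rightarrow> ('a \<Rightarrow> real) \<Rightarrow> 'a \<Rightarrow> bool" where
  "strict_local_max_on A f a \<longleftrightarrow> a \<in> A \<and> (\<forall>\<^sub>F b in at a within A. f b < f a)"

definition strict_local_min_on :: "'a::topological_space set \<Rightarrow> ('a \<Rightarrow> real) \<Rightarrow> 'a \<Rightarrow> bool" where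
  "strict_local_min_on A f a \<longleftrightarrow> a \<in> A \<and> (\<forall>\<^sub>F b in at a within A. f a < f b)"

end

theory Submission
  imports Defs
begin

text \<open>
  Let \<open>f\<^sub>t(a)\<close> be the section volume. Near a diagonal direction it is given by one explicit
  expression, and the claim is that \<open>S\<close> is, up to a positive factor, the coefficient of the
  quadratic term of that expression.

  For a unit vector \<open>a\<close> without zero components,
  \<open>f\<^sub>t(a) = (\<Sum>I. (-1)^|I| (\<sigma>/2 - t - \<Sum>i\<in>I. |a\<^sub>i|)\<^sub>+^(d-1)) / ((d-1)! \<Prod>i. |a\<^sub>i|)\<close>
  with \<open>\<sigma> = \<Sum>i. |a\<^sub>i|\<close> (\<open>section_volume_formula\<close>). It is obtained from the prism that the section
  sweeps out when it is moved by a basis vector \<open>e\<close>. Sliced parallel to the section, the prism has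
  volume \<open>|a \<bullet> e|\<close> times the section volume (\<open>emeasure_oblique_prism\<close>); sliced by lines parallel
  to \<open>e\<close>, its volume is that of the shadow of the section on the facet orthogonal to \<open>e\<close>
  (\<open>emeasure_prism_along_axis\<close>). The shadow is a slab of a \<open>(d-1)\<close>-dimensional cube, whose volume
  follows by repeated integration of truncated powers (\<open>emeasure_cube_slab\<close>). The prism
  gives an identity for each single hyperplane, whereas differentiating the volume on one side
  of a moving hyperplane would determine \<open>f\<^sub>t\<close> only for almost every \<open>t\<close>.

  Write \<open>|a\<^sub>i| = m (1 + v\<^sub>i)\<close> where \<open>m\<close> is the mean of the \<open>|a\<^sub>i|\<close>. Then \<open>\<Sum>i. v\<^sub>i = 0\<close>, and \<open>norm a = 1\<close>
  forces \<open>1/m = sqrt (d + |v|\<^sup>2)\<close>, so \<open>f\<^sub>t(a)\<close> becomes a function of \<open>v\<close> alone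
  (\<open>section_volume_eq_profile\<close>): the constraint of the sphere has been absorbed, and the diagonal
  directions are exactly \<open>v = 0\<close>. Everything in the formula is invariant under permutations of
  the coordinates. Hence on the hyperplane \<open>\<Sum>i. v\<^sub>i = 0\<close> the linear terms cancel and the quadratic
  ones add up to a multiple of \<open>|v|\<^sup>2\<close> (\<open>sum_Pow_card_linear\<close>, \<open>sum_Pow_card_quadratic\<close>). Since
  \<open>d - 1 \<ge> 3\<close>, the truncated powers are twice continuously differentiable, so the remainder is
  \<open>o(|v|\<^sup>2)\<close>.

  Collecting the coefficient of \<open>|v|\<^sup>2\<close> yields the three terms of \<open>p\<^sub>i\<^sub>,\<^sub>d\<close>. The first, with
  \<open>i (d - i)\<close>, comes from the squares of \<open>\<Sum>i\<in>I. v\<^sub>i\<close> averaged over all \<open>I\<close> of size \<open>i\<close>; the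
  change of \<open>t/m\<close> contributes \<open>d/2 - z\<close> times \<open>z - i\<close>; the prefactors \<open>1/m\<close> and
  \<open>1 / \<Prod>i. (1 + v\<^sub>i)\<close> contribute to \<open>(z - i)\<^sup>2\<close>; rewriting \<open>d/2 - z\<close> as \<open>(d/2 - i) - (z - i)\<close> gives
  \<open>p\<^sub>i\<^sub>,\<^sub>d\<close>. So \<open>f\<^sub>t(a)\<close> exceeds its value at the diagonal by \<open>K S |v|\<^sup>2 + o(|v|\<^sup>2)\<close> with \<open>K > 0\<close>
  (\<open>tendsto_section_volume_quotient\<close>), and the sign of \<open>S\<close> decides.
\<close>

section \<open>Lebesgue measure in orthonormal coordinates\<close>

text \<open>
  Evaluate \<open>\<integral>\<integral> 1\<^sub>A(x) 1\<^sub>B(y - x)\<close> over \<open>\<mu> \<times> lborel\<close>, with \<open>B\<close> the unit ball, in both orders. Integrating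
  first over \<open>y\<close> gives the left-hand side. Integrating first over \<open>x\<close>, translation invariance of
  \<open>\<mu>\<close> moves \<open>y\<close> from \<open>B\<close> to \<open>A\<close>, and the symmetry of \<open>B\<close> gives the right-hand side.
\<close>

lemma translation_invariant_measure_unique:
  fixes \<mu> :: "'a::euclidean_space measure"
  assumes "sigma_finite_measure \<mu>" and sets_\<mu> [measurable_cong]: "sets \<mu> = sets borel"
    and trans: "\<And>w. distr \<mu> borel (\<lambda>x. x + w) = \<mu>"
    and A [measurable]: "A \<in> sets borel"
  shows "emeasure \<mu> A * emeasure lborel (cball (0::'a) 1) = emeasure lborel A * emeasure \<mu> (cball 0 1)"
proof -
  interpret \<mu>: sigma_finite_measure \<mu> by fact
  interpret pair_sigma_finite \<mu> lborel
    by unfold_locales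
  define B :: "'a set" where "B = cball 0 1"
  have [measurable]: "B \<in> sets borel" by (simp add: B_def)
  have symB: "indicator B (- x) = (indicator B x :: ennreal)" for x
    by (simp add: B_def indicator_def)
  have shift: "(\<integral>\<^sup>+ x. f (x + w) \<partial>\<mu>) = (\<integral>\<^sup>+ x. f x \<partial>\<mu>)"
    if [measurable]: "f \<in> borel_measurable borel" for f w
    by (subst (2) trans[of w, symmetric]) (simp add: nn_integral_distr)
  have shiftl: "(\<integral>\<^sup>+ x. f (w + x) \<partial>lborel) = (\<integral>\<^sup>+ x. f x \<partial>lborel)"
    if [measurable]: "f \<in> borel_measurable borel" for f :: "'a \<Rightarrow> ennreal" and w
    by (subst (2) lborel_distr_plus[of w, symmetric]) (simp add: nn_integral_distr)
  have "emeasure \<mu> A * emeasure lborel B = (\<integral>\<^sup>+ x. indicator A x * emeasure lborel B \<partial>\<mu>)"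
    by (simp add: nn_integral_multc)
  also have "\<dots> = (\<integral>\<^sup>+ x. \<integral>\<^sup>+ y. indicator A x * indicator B (y - x) \<partial>lborel \<partial>\<mu>)"
  proof (intro nn_integral_cong)
    fix x
    have "(\<integral>\<^sup>+ y. indicator B (y - x) \<partial>lborel) = emeasure lborel B"
      using shiftl[of "\<lambda>y. indicator B y" "-x"] by simp
    thus "indicator A x * emeasure lborel B = (\<integral>\<^sup>+ y. indicator A x * indicator B (y - x) \<partial>lborel)"
      by (simp add: nn_integral_cmult)
  qed
  also have "\<dots> = (\<integral>\<^sup>+ y. \<integral>\<^sup>+ x. indicator A x * indicator B (y - x) \<partial>\<mu> \<partial>lborel)"
    by (rule Fubini'[symmetric]) measurable
  also have "\<dots> = (\<integral>\<^sup>+ y. \<integral>\<^sup>+ x. indicator A (x + y) * indicator B x \<partial>\<mu> \<partial>lborel)"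
  proof (rule nn_integral_cong)
    fix y
    show "(\<integral>\<^sup>+ x. indicator A x * indicator B (y - x) \<partial>\<mu>)
        = (\<integral>\<^sup>+ x. indicator A (x + y) * indicator B x \<partial>\<mu>)"
      using shift[of "\<lambda>x. indicator A x * indicator B (y - x)" y] by (simp add: symB)
  qed
  also have "\<dots> = (\<integral>\<^sup>+ x. \<integral>\<^sup>+ y. indicator A (x + y) * indicator B x \<partial>lborel \<partial>\<mu>)"
    by (rule Fubini') measurable
  also have "\<dots> = (\<integral>\<^sup>+ x. emeasure lborel A * indicator B x \<partial>\<mu>)"
  proof (intro nn_integral_cong)
    fix x
    have "(\<integral>\<^sup>+ y. indicator A (x + y) \<partial>lborel) = emeasure lborel A"
      using shiftl[of "\<lambda>y. indicator A y" x] by simp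
    thus "(\<integral>\<^sup>+ y. indicator A (x + y) * indicator B x \<partial>lborel) = emeasure lborel A * indicator B x"
      by (simp add: nn_integral_multc)
  qed
  also have "\<dots> = emeasure lborel A * emeasure \<mu> B"
    by (simp add: nn_integral_cmult)
  finally show ?thesis by (simp add: B_def)
qed

lemma distr_PiM_lborel_translation:
  assumes "finite I"
  shows "distr (PiM I (\<lambda>_. lborel)) (PiM I (\<lambda>_. lborel)) (\<lambda>c. \<lambda>i\<in>I. c i + w i)
       = PiM I (\<lambda>_. lborel :: real measure)" (is "?D = ?P")
proof -
  interpret product_sigma_finite "\<lambda>_. lborel :: real measure" by standard
  show ?thesis
  proof (rule PiM_eqI)
    fix A :: "_ \<Rightarrow> real set" assume A: "\<And>i. i \<in> I \<Longrightarrow> A i \<in> sets lborel"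
    have [measurable]: "(\<lambda>c. \<lambda>i\<in>I. c i + w i) \<in> ?P \<rightarrow>\<^sub>M ?P"
      by measurable
    have vs: "(\<lambda>x. w i + x) -` A i \<in> sets lborel" if "i \<in> I" for i
      using measurable_sets[of "\<lambda>x. w i + x" borel borel "A i"] A[OF that] by simp
    have "emeasure ?D (Pi\<^sub>E I A) = emeasure ?P (Pi\<^sub>E I (\<lambda>i. (\<lambda>x. w i + x) -` A i))"
      using A assms
      by (subst emeasure_distr)
         (auto intro!: arg_cong[where f = "emeasure ?P"] simp: space_PiM PiE_iff extensional_def add.commute)
    also have "\<dots> = (\<Prod>i\<in>I. emeasure lborel ((\<lambda>x. w i + x) -` A i))"
      using vs assms by (intro emeasure_PiM) auto
    also have "\<dots> = (\<Prod>i\<in>I. emeasure lborel (A i))"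
    proof (intro prod.cong refl)
      fix i assume "i \<in> I"
      have "emeasure lborel (A i) = emeasure (distr lborel borel ((+) (w i))) (A i)"
        by (simp add: lborel_distr_plus)
      also have "\<dots> = emeasure lborel ((\<lambda>x. w i + x) -` A i)"
        using A[OF \<open>i \<in> I\<close>] by (subst emeasure_distr) auto
      finally show "emeasure lborel ((\<lambda>x. w i + x) -` A i) = emeasure lborel (A i)" ..
    qed
    finally show "emeasure ?D (Pi\<^sub>E I A) = (\<Prod>i\<in>I. emeasure lborel (A i))" .
  qed (use assms in auto)
qed

lemma norm_sum_orthonormal:
  fixes B :: "'a::euclidean_space set"
  assumes "finite B" "pairwise orthogonal B" "\<And>b. b \<in> B \<Longrightarrow> norm b = 1"
  shows "norm (\<Sum>b\<in>B. c b *\<^sub>R b) = sqrt (\<Sum>b\<in>B. (c b)\<^sup>2)"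
proof -
  have "(norm (\<Sum>b\<in>B. c b *\<^sub>R b))\<^sup>2 = (\<Sum>b\<in>B. (norm (c b *\<^sub>R b))\<^sup>2)"
    using assms(1,2)
    by (intro norm_sum_Pythagorean) (auto simp: pairwise_def orthogonal_def)
  also have "\<dots> = (\<Sum>b\<in>B. (c b)\<^sup>2)"
    using assms(3) by (intro sum.cong) (auto simp: power_mult_distrib)
  finally show ?thesis by (metis norm_ge_zero real_sqrt_unique)
qed

lemma inner_sum_orthonormal:
  fixes B :: "'a::euclidean_space set"
  assumes "finite B" "pairwise orthogonal B" "\<And>b. b \<in> B \<Longrightarrow> norm b = 1" "b \<in> B"
  shows "(\<Sum>b\<in>B. c b *\<^sub>R b) \<bullet> b = c b"
proof -
  have "(\<Sum>b\<in>B. c b *\<^sub>R b) \<bullet> b = (\<Sum>b'\<in>B. c b' * (b' \<bullet> b))"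
    by (simp add: inner_sum_left)
  also have "\<dots> = (\<Sum>b'\<in>B. if b' = b then c b else 0)"
    using assms by (intro sum.cong) (auto simp: pairwise_def orthogonal_def dot_square_norm)
  finally show ?thesis using assms by simp
qed

lemma orthonormal_expansion:
  fixes B :: "'a::euclidean_space set"
  assumes "finite B" "pairwise orthogonal B" "\<And>b. b \<in> B \<Longrightarrow> norm b = 1" "x \<in> span B"
  shows "(\<Sum>b\<in>B. (x \<bullet> b) *\<^sub>R b) = x"
proof -
  obtain u where "x = (\<Sum>b\<in>B. u b *\<^sub>R b)"
    using assms(4) span_finite[OF assms(1)] by auto
  thus ?thesis using inner_sum_orthonormal[OF assms(1-3)] by (auto intro!: sum.cong)
qed

text \<open>
  The image measure is translation invariant, hence a multiple of Lebesgue measure. The factor is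
  1 because the unit ball reads \<open>\<Sum>b. (c b)\<^sup>2 \<le> 1\<close> in every orthonormal system of coordinates, so that
  its measure depends on the dimension only.
\<close>

lemma lborel_eq_orthonormal_coordinates:
  fixes B :: "'a::euclidean_space set"
  assumes fin: "finite B" and orth: "pairwise orthogonal B" and unit: "\<And>b. b \<in> B \<Longrightarrow> norm b = 1"
    and span: "span B = UNIV"
  shows "lborel = distr (PiM B (\<lambda>_. lborel)) borel (\<lambda>c. \<Sum>b\<in>B. c b *\<^sub>R b)"
proof -
  define L where "L = (\<lambda>c. \<Sum>b\<in>B. c b *\<^sub>R b)"
  define P where "P = PiM B (\<lambda>_. lborel :: real measure)"
  define \<mu> where "\<mu> = distr P borel L"
  have L [measurable]: "L \<in> P \<rightarrow>\<^sub>M borel"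
    unfolding L_def P_def by measurable
  have sets_mu [measurable_cong, simp]: "sets \<mu> = sets borel" and space_mu [simp]: "space \<mu> = UNIV"
    by (auto simp: \<mu>_def)
  have "independent B"
    using orth unit by (intro pairwise_orthogonal_independent) force+
  hence card: "card B = DIM('a)"
    using span dim_eq_card_independent dim_span dim_UNIV by metis
  have ball: "emeasure \<mu> (cball 0 r) = ennreal (unit_ball_vol (real (DIM('a))) * r ^ DIM('a))" if "r > 0" for r
  proof -
    have "emeasure \<mu> (cball 0 r) = emeasure P ({f. sqrt (\<Sum>i\<in>B. (f i)\<^sup>2) \<le> r} \<inter> space P)"
      unfolding \<mu>_def
      by (subst emeasure_distr[OF L])
         (auto intro!: arg_cong[where f = "emeasure P"] simp: L_def norm_sum_orthonormal[OF fin orth unit])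
    thus ?thesis
      unfolding P_def using emeasure_cball_aux[OF fin that] card by simp
  qed
  have "sigma_finite_measure \<mu>"
  proof
    have "(\<Union>n::nat. cball 0 (real (Suc n))) = (UNIV :: 'a set)"
    proof (intro set_eqI iffI UNIV_I)
      fix x :: 'a
      obtain n where "norm x \<le> real n" using real_arch_simple by blast
      thus "x \<in> (\<Union>n::nat. cball 0 (real (Suc n)))" by (auto intro!: exI[of _ n])
    qed
    thus "\<exists>A. countable A \<and> A \<subseteq> sets \<mu> \<and> \<Union>A = space \<mu> \<and> (\<forall>a\<in>A. emeasure \<mu> a \<noteq> \<infinity>)"
      by (intro exI[of _ "range (\<lambda>n::nat. cball 0 (real (Suc n)))"]) (auto simp: ball)
  qed
  have trans: "distr \<mu> borel (\<lambda>x. x + w) = \<mu>" for w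
  proof -
    have "w \<in> span B" by (simp add: span)
    have eq: "L c + w = L (\<lambda>b\<in>B. c b + w \<bullet> b)" for c
      using orthonormal_expansion[OF fin orth unit \<open>w \<in> span B\<close>]
      by (simp add: L_def scaleR_add_left sum.distrib)
    have sh [measurable]: "(\<lambda>c. \<lambda>b\<in>B. c b + w \<bullet> b) \<in> P \<rightarrow>\<^sub>M P"
      unfolding P_def by measurable
    have "distr \<mu> borel (\<lambda>x. x + w) = distr P borel (\<lambda>c. L c + w)"
      unfolding \<mu>_def by (subst distr_distr) (auto simp: o_def)
    also have "\<dots> = distr P borel (\<lambda>c. L (\<lambda>b\<in>B. c b + w \<bullet> b))"
      by (simp only: eq)
    also have "\<dots> = distr (distr P P (\<lambda>c. \<lambda>b\<in>B. c b + w \<bullet> b)) borel L"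
      by (subst distr_distr[OF L sh]) (auto simp: o_def)
    also have "\<dots> = \<mu>"
      unfolding P_def distr_PiM_lborel_translation[OF fin] by (simp add: \<mu>_def P_def)
    finally show ?thesis .
  qed
  have "emeasure lborel A = emeasure \<mu> A" if "A \<in> sets borel" for A
  proof -
    define \<kappa> where "\<kappa> = emeasure lborel (cball (0::'a) 1)"
    have "\<kappa> = emeasure \<mu> (cball 0 1)"
      by (simp add: \<kappa>_def ball emeasure_cball)
    moreover have "\<kappa> \<noteq> 0" "\<kappa> \<noteq> \<infinity>"
      using unit_ball_vol_pos[of "real DIM('a)"]
      by (auto simp: \<kappa>_def emeasure_cball simp del: unit_ball_vol_pos)
    moreover have "\<kappa> * emeasure lborel A = \<kappa> * emeasure \<mu> A"
      using translation_invariant_measure_unique[OF \<open>sigma_finite_measure \<mu>\<close> sets_mu trans that] calculation(1)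
      by (simp add: \<kappa>_def mult.commute)
    ultimately show ?thesis
      by (simp add: ennreal_mult_cancel_left)
  qed
  hence "lborel = \<mu>" by (intro measure_eqI) auto
  thus ?thesis by (simp add: \<mu>_def P_def L_def)
qed

section \<open>The volume of an oblique prism, computed in two ways\<close>

lemma sets_unit_box_Collect:
  assumes "finite J" and Q: "{c \<in> space (PiM J (\<lambda>_. lborel)). Q c} \<in> sets (PiM J (\<lambda>_. lborel))"
  shows "{c \<in> PiE J (\<lambda>_. {0..1::real}). Q c} \<in> sets (PiM J (\<lambda>_. lborel))"
proof -
  have "{c \<in> PiE J (\<lambda>_. {0..1::real}). Q c} = PiE J (\<lambda>_. {0..1}) \<inter> {c \<in> space (PiM J (\<lambda>_. lborel)). Q c}"
    by (auto simp: space_PiM)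
  also have "\<dots> \<in> sets (PiM J (\<lambda>_. lborel))"
    using assms(1) by (intro sets.Int Q sets_PiM_I_finite) auto
  finally show ?thesis .
qed

lemma emeasure_lborel_unit_interval_scaled:
  fixes \<alpha> :: real
  assumes "\<alpha> \<noteq> 0"
  shows "emeasure lborel {u. u / \<alpha> \<in> {0..1}} = ennreal \<bar>\<alpha>\<bar>"
proof -
  have "{u. u / \<alpha> \<in> {0..1}} = (if \<alpha> > 0 then {0..\<alpha>} else {\<alpha>..0})"
    using assms by (auto simp: field_simps split: if_splits)
  thus ?thesis using assms by auto
qed

text \<open>
  The point \<open>x\<close> lies at height \<open>a \<bullet> (x - p)\<close> above the hyperplane through \<open>p\<close>, and \<open>x - \<tau> x *\<^sub>R e\<close> is
  its projection to that hyperplane along \<open>e\<close>. In orthonormal coordinates that extend those of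
  the hyperplane by \<open>a\<close>, the slice at height \<open>u\<close> is the base translated by a multiple of \<open>u\<close>, so
  all slices have the volume of the base, for heights \<open>u\<close> in an interval of length \<open>|a \<bullet> e|\<close>.
\<close>

lemma emeasure_oblique_prism:
  fixes a e p :: "'a::euclidean_space"
  assumes a: "norm a = 1" and ae: "a \<bullet> e \<noteq> 0"
    and fin: "finite B" and orth: "pairwise orthogonal B" and unit: "\<And>b. b \<in> B \<Longrightarrow> norm b = 1"
    and span: "span B = {x. a \<bullet> x = 0}" and C [measurable]: "C \<in> sets borel"
  defines "\<tau> \<equiv> \<lambda>x. a \<bullet> (x - p) / (a \<bullet> e)"
  shows "emeasure lborel {x. \<tau> x \<in> {0..1} \<and> x - \<tau> x *\<^sub>R e \<in> C}
       = ennreal \<bar>a \<bullet> e\<bar> * emeasure (PiM B (\<lambda>_. lborel)) {c \<in> extensional B. p + (\<Sum>b\<in>B. c b *\<^sub>R b) \<in> C}"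
proof -
  interpret product_sigma_finite "\<lambda>_. lborel :: real measure" by standard
  have perp: "a \<bullet> b = 0" if "b \<in> B" for b
    using span span_base[OF that] by auto
  have "a \<notin> B" using perp[of a] a by (auto simp: dot_square_norm)
  define B' where "B' = insert a B"
  have fin': "finite B'" and unit': "\<And>b. b \<in> B' \<Longrightarrow> norm b = 1"
    using fin unit a by (auto simp: B'_def)
  have orth': "pairwise orthogonal B'"
    using orth perp by (auto simp: B'_def pairwise_insert orthogonal_def inner_commute)
  have "x \<in> span B'" for x
  proof -
    have "x - (a \<bullet> x) *\<^sub>R a \<in> span B"
      using a by (simp add: span inner_diff_right dot_square_norm)
    hence "x - (a \<bullet> x) *\<^sub>R a \<in> span B'"
      using span_mono[of B B'] by (auto simp: B'_def)
    moreover have "(a \<bullet> x) *\<^sub>R a \<in> span B'"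
      by (intro span_mul span_base) (simp add: B'_def)
    ultimately show ?thesis
      by (metis diff_add_cancel span_add)
  qed
  hence span': "span B' = UNIV" by blast
  define P where "P = PiM B (\<lambda>_. lborel :: real measure)"
  define L where "L = (\<lambda>c. \<Sum>b\<in>B. c b *\<^sub>R b)"
  define L' where "L' = (\<lambda>c. \<Sum>b\<in>B'. c b *\<^sub>R b)"
  define K where "K = {c \<in> extensional B. p + L c \<in> C}"
  define X where "X = {x. \<tau> x \<in> {0..1} \<and> x - \<tau> x *\<^sub>R e \<in> C}"
  have Lm [measurable]: "L \<in> borel_measurable P"
    unfolding P_def L_def by measurable
  have Lm' [measurable]: "L' \<in> borel_measurable (PiM B' (\<lambda>_. lborel))"
    unfolding L'_def by measurable
  have lborel_L': "lborel = distr (PiM B' (\<lambda>_. lborel)) borel L'"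
    unfolding L'_def by (rule lborel_eq_orthonormal_coordinates[OF fin' orth' unit' span'])
  have \<tau>m [measurable]: "\<tau> \<in> borel_measurable borel"
    unfolding \<tau>_def by measurable
  have X [measurable]: "X \<in> sets borel"
    unfolding X_def by measurable
  have spP: "space P = extensional B" by (simp add: P_def space_PiM PiE_def)
  have K [measurable]: "K \<in> sets P"
  proof -
    have "K = {c \<in> space P. p + L c \<in> C}" by (simp add: K_def spP)
    also have "\<dots> \<in> sets P" by measurable
    finally show ?thesis .
  qed
  have slice: "indicator X (p + L' (c(a := u)))
      = (indicator {u. u / (a \<bullet> e) \<in> {0..1}} u * indicator K (\<lambda>b\<in>B. c b + (- (u / (a \<bullet> e)) * (e \<bullet> b))) :: ennreal)"
    if "c \<in> space P" for c u
  proof -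
    have L': "L' (c(a := u)) = u *\<^sub>R a + L c"
    proof -
      have "L' (c(a := u)) = u *\<^sub>R a + (\<Sum>b\<in>B. (c(a := u)) b *\<^sub>R b)"
        using fin \<open>a \<notin> B\<close> by (simp add: L'_def B'_def)
      also have "(\<Sum>b\<in>B. (c(a := u)) b *\<^sub>R b) = L c"
        unfolding L_def using \<open>a \<notin> B\<close> by (intro sum.cong) auto
      finally show ?thesis .
    qed
    have aL: "a \<bullet> L c = 0"
      using perp by (simp add: L_def inner_sum_right)
    have \<tau>: "\<tau> (p + L' (c(a := u))) = u / (a \<bullet> e)"
      using a by (simp add: \<tau>_def L' inner_add_right aL dot_square_norm)
    define w where "w = u *\<^sub>R a - (u / (a \<bullet> e)) *\<^sub>R e"
    have "w \<in> span B"
      using a ae by (simp add: span w_def inner_diff_right dot_square_norm)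
    hence "w = (\<Sum>b\<in>B. (w \<bullet> b) *\<^sub>R b)"
      using orthonormal_expansion[OF fin orth unit] by simp
    also have "\<dots> = (\<Sum>b\<in>B. (- (u / (a \<bullet> e)) * (e \<bullet> b)) *\<^sub>R b)"
      using perp by (intro sum.cong) (auto simp: w_def inner_diff_left)
    finally have w: "w = \<dots>" .
    \<comment> \<open>the vector \<open>w\<close> has no component along \<open>a\<close>: it translates within the hyperplane\<close>
    have "p + L' (c(a := u)) - (u / (a \<bullet> e)) *\<^sub>R e = p + (L c + w)"
      by (simp add: L' w_def)
    also have "L c + w = L (\<lambda>b\<in>B. c b + (- (u / (a \<bullet> e)) * (e \<bullet> b)))"
      unfolding w L_def sum.distrib[symmetric] scaleR_add_left[symmetric] by (intro sum.cong) auto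
    finally have eq: "p + L' (c(a := u)) - (u / (a \<bullet> e)) *\<^sub>R e
        = p + L (\<lambda>b\<in>B. c b + (- (u / (a \<bullet> e)) * (e \<bullet> b)))" .
    show ?thesis
      unfolding X_def K_def indicator_def mem_Collect_eq \<tau> eq by auto
  qed
  have "emeasure lborel X = (\<integral>\<^sup>+ x. indicator X x \<partial>lborel)"
    by simp
  also have "\<dots> = (\<integral>\<^sup>+ x. indicator X (p + x) \<partial>lborel)"
    by (subst (1) lborel_distr_plus[of p, symmetric], subst nn_integral_distr) auto
  also have "\<dots> = (\<integral>\<^sup>+ c. indicator X (p + L' c) \<partial>PiM B' (\<lambda>_. lborel))"
    by (subst lborel_L', subst nn_integral_distr) auto
  also have "\<dots> = (\<integral>\<^sup>+ u. \<integral>\<^sup>+ c. indicator X (p + L' (c(a := u))) \<partial>P \<partial>lborel)"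
    unfolding B'_def P_def using \<open>a \<notin> B\<close> fin
    by (intro product_nn_integral_insert_rev) (auto simp: B'_def[symmetric])
  also have "\<dots> = (\<integral>\<^sup>+ u. indicator {u. u / (a \<bullet> e) \<in> {0..1}} u * emeasure P K \<partial>lborel)"
  proof (rule nn_integral_cong)
    fix u :: real
    define w where "w = (\<lambda>b. - (u / (a \<bullet> e)) * (e \<bullet> b))"
    have sh [measurable]: "(\<lambda>c. \<lambda>b\<in>B. c b + w b) \<in> P \<rightarrow>\<^sub>M P"
      unfolding P_def by measurable
    have "(\<integral>\<^sup>+ c. indicator X (p + L' (c(a := u))) \<partial>P)
        = (\<integral>\<^sup>+ c. indicator {u. u / (a \<bullet> e) \<in> {0..1}} u * indicator K (\<lambda>b\<in>B. c b + w b) \<partial>P)"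
      unfolding w_def by (intro nn_integral_cong slice)
    also have "\<dots> = indicator {u. u / (a \<bullet> e) \<in> {0..1}} u * (\<integral>\<^sup>+ c. indicator K (\<lambda>b\<in>B. c b + w b) \<partial>P)"
      by (intro nn_integral_cmult) measurable
    also have "(\<integral>\<^sup>+ c. indicator K (\<lambda>b\<in>B. c b + w b) \<partial>P)
        = (\<integral>\<^sup>+ c. indicator K c \<partial>distr P P (\<lambda>c. \<lambda>b\<in>B. c b + w b))"
      by (subst nn_integral_distr) auto
    also have "distr P P (\<lambda>c. \<lambda>b\<in>B. c b + w b) = P"
      unfolding P_def by (rule distr_PiM_lborel_translation[OF fin])
    also have "(\<integral>\<^sup>+ c. indicator K c \<partial>P) = emeasure P K" by simp
    finally show "(\<integral>\<^sup>+ c. indicator X (p + L' (c(a := u))) \<partial>P)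
        = indicator {u. u / (a \<bullet> e) \<in> {0..1}} u * emeasure P K" .
  qed
  also have "\<dots> = ennreal \<bar>a \<bullet> e\<bar> * emeasure P K"
    using emeasure_lborel_unit_interval_scaled[OF ae] by (simp add: nn_integral_multc)
  finally show ?thesis
    by (simp add: X_def P_def K_def L_def)
qed

text \<open>
  Each line parallel to \<open>e\<close> either misses the prism or meets it in a segment of unit length, since
  \<open>\<tau>\<close> grows along the line with slope 1 while the projection \<open>x - \<tau> x *\<^sub>R e\<close> is constant on it. The
  volume is therefore that of the shadow in the remaining coordinates. The fraction in the shadow
  is the \<open>e\<close>-coordinate of that projection.
\<close>

lemma emeasure_prism_along_axis:
  fixes a e :: "'a::euclidean_space" and s :: real
  assumes e: "e \<in> Basis" and ae: "a \<bullet> e \<noteq> 0"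
  defines "\<tau> \<equiv> \<lambda>x. (a \<bullet> x - s) / (a \<bullet> e)"
  shows "emeasure lborel {x. \<tau> x \<in> {0..1} \<and> x - \<tau> x *\<^sub>R e \<in> cbox 0 One}
       = emeasure (PiM (Basis - {e}) (\<lambda>_. lborel))
           {c \<in> PiE (Basis - {e}) (\<lambda>_. {0..1}).
              (s - (\<Sum>b\<in>Basis - {e}. (a \<bullet> b) * c b)) / (a \<bullet> e) \<in> {0..1}}"
proof -
  interpret product_sigma_finite "\<lambda>_. lborel :: real measure" by standard
  define J where "J = (Basis :: 'a set) - {e}"
  have J: "finite J" "e \<notin> J" "insert e J = Basis" using e by (auto simp: J_def)
  define P where "P = PiM J (\<lambda>_. lborel :: real measure)"
  define L where "L = (\<lambda>c. \<Sum>b\<in>Basis. c b *\<^sub>R (b::'a))"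
  define X where "X = {x. \<tau> x \<in> {0..1} \<and> x - \<tau> x *\<^sub>R e \<in> cbox 0 One}"
  \<comment> \<open>the coordinate along \<open>e\<close> at which the line over \<open>c\<close> crosses the hyperplane\<close>
  define q where "q = (\<lambda>c. (s - (\<Sum>b\<in>J. (a \<bullet> b) * c b)) / (a \<bullet> e))"
  define Y where "Y = {c \<in> PiE J (\<lambda>_. {0..1}). q c \<in> {0..1}}"
  have L_meas [measurable]: "L \<in> borel_measurable (PiM Basis (\<lambda>_. lborel))"
    unfolding L_def by measurable
  have q_meas [measurable]: "q \<in> borel_measurable P"
    unfolding q_def P_def by measurable
  have [measurable]: "X \<in> sets borel"
    unfolding X_def \<tau>_def by measurable
  have Y [measurable]: "Y \<in> sets P"
    unfolding Y_def P_def using J(1) by (rule sets_unit_box_Collect) (fold P_def, measurable)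
  have slice: "indicator X (L (c(e := y))) = (indicator Y c * indicator {q c..q c + 1} y :: ennreal)"
    if "c \<in> space P" for c y
  proof -
    have Lb: "L f \<bullet> b = f b" if "b \<in> Basis" for f b
      using that by (simp add: L_def)
    have "a \<bullet> L (c(e := y)) = (\<Sum>b\<in>insert e J. (c(e := y)) b * (a \<bullet> b))"
      by (simp add: L_def J(3) inner_sum_right del: fun_upd_apply)
    also have "\<dots> = y * (a \<bullet> e) + (\<Sum>b\<in>J. (a \<bullet> b) * c b)"
      using J(1,2) by (auto intro!: sum.cong)
    finally have \<tau>: "\<tau> (L (c(e := y))) = y - q c"
      using ae by (simp add: \<tau>_def q_def field_simps)
    have "L (c(e := y)) - (y - q c) *\<^sub>R e \<in> cbox 0 One
        \<longleftrightarrow> (\<forall>b\<in>insert e J. (L (c(e := y)) - (y - q c) *\<^sub>R e) \<bullet> b \<in> {0..1})"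
      unfolding J(3) by (auto simp: mem_box)
    also have "\<dots> \<longleftrightarrow> q c \<in> {0..1} \<and> (\<forall>b\<in>J. c b \<in> {0..1})"
    proof -
      have "(L (c(e := y)) - (y - q c) *\<^sub>R e) \<bullet> b = (if b = e then q c else c b)" if "b \<in> insert e J" for b
        using that e J(2) Lb[of b] unfolding J(3)
        by (auto simp: inner_diff_left inner_Basis)
      thus ?thesis using J(2) by auto
    qed
    finally show ?thesis
      using that by (auto simp: X_def Y_def \<tau> indicator_def P_def space_PiM PiE_iff)
  qed
  have "emeasure lborel X = (\<integral>\<^sup>+ x. indicator X x \<partial>lborel)"
    by simp
  also have "\<dots> = (\<integral>\<^sup>+ c. indicator X (L c) \<partial>PiM Basis (\<lambda>_. lborel))"
    by (subst lborel_eq, fold L_def, subst nn_integral_distr) auto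
  also have "\<dots> = (\<integral>\<^sup>+ c. \<integral>\<^sup>+ y. indicator X (L (c(e := y))) \<partial>lborel \<partial>P)"
    unfolding J(3)[symmetric] P_def using J(1,2)
    by (intro product_nn_integral_insert) (simp_all add: J(3))
  also have "\<dots> = (\<integral>\<^sup>+ c. indicator Y c \<partial>P)"
  proof (rule nn_integral_cong)
    fix c assume "c \<in> space P"
    hence "(\<integral>\<^sup>+ y. indicator X (L (c(e := y))) \<partial>lborel)
         = (\<integral>\<^sup>+ y. indicator Y c * indicator {q c..q c + 1} y \<partial>lborel)"
      by (simp add: slice)
    also have "\<dots> = indicator Y c" by (simp add: nn_integral_cmult)
    finally show "(\<integral>\<^sup>+ y. indicator X (L (c(e := y))) \<partial>lborel) = indicator Y c" .
  qed
  also have "\<dots> = emeasure P Y" by simp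
  finally show ?thesis unfolding X_def P_def Y_def q_def J_def .
qed

section \<open>Slabs of the unit cube\<close>

text \<open>
  The truncated power \<open>x\<^sub>+^n\<close>. For \<open>n = 0\<close> it is the indicator function of \<open>{0..}\<close>, unlike
  \<open>(max 0 x) ^ n\<close>; this is what lets the volume formula below start its induction from the
  zero-dimensional cube.
\<close>

definition pos_power :: "nat \<Rightarrow> real \<Rightarrow> real" where
  "pos_power n x = (if 0 \<le> x then x ^ n else 0)"

lemma measurable_pos_power [measurable]: "pos_power n \<in> borel_measurable borel"
  unfolding pos_power_def by measurable

lemma continuous_on_pos_power:
  assumes "0 < n"
  shows "continuous_on A (pos_power n)"
proof -
  have "pos_power n = (\<lambda>x. (max 0 x) ^ n)"
    using assms by (auto simp: pos_power_def fun_eq_iff max_def)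
  thus ?thesis by (auto intro!: continuous_intros)
qed

lemma has_field_derivative_pos_power:
  assumes "x \<noteq> 0 \<or> 0 < n"
  shows "(pos_power (Suc n) has_field_derivative (1 + real n) * pos_power n x) (at x)"
proof -
  consider "x > 0" | "x < 0" | "x = 0" "0 < n" using assms by linarith
  thus ?thesis
  proof cases
    case 1
    have "((\<lambda>x. x ^ Suc n) has_field_derivative (1 + real n) * x ^ n) (at x)"
      by (rule derivative_eq_intros refl)+ simp
    hence "(pos_power (Suc n) has_field_derivative (1 + real n) * x ^ n) (at x)"
      by (rule has_field_derivative_transform_within_open[where S = "{0<..}"])
         (use 1 in \<open>auto simp: pos_power_def\<close>)
    thus ?thesis using 1 by (simp add: pos_power_def[of n])
  next
    case 2
    have "((\<lambda>x. 0::real) has_field_derivative 0) (at x)" by simp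
    hence "(pos_power (Suc n) has_field_derivative 0) (at x)"
      by (rule has_field_derivative_transform_within_open[where S = "{..<0}"])
         (use 2 in \<open>auto simp: pos_power_def\<close>)
    thus ?thesis using 2 by (simp add: pos_power_def[of n])
  next
    case 3
    have "pos_power n \<midarrow>0\<rightarrow> pos_power n 0"
      using continuous_on_pos_power[of n UNIV] 3 by (simp add: continuous_on_def)
    moreover have "\<forall>\<^sub>F h in at 0. pos_power n h = pos_power (Suc n) h / h"
      by (auto simp: eventually_at_filter pos_power_def)
    ultimately have "(\<lambda>h. pos_power (Suc n) h / h) \<midarrow>0\<rightarrow> pos_power n 0"
      by (rule Lim_transform_eventually)
    thus ?thesis
      using 3 by (simp add: DERIV_def pos_power_def[of _ 0] power_0_left)
  qed
qed

text \<open>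
  Centring the integration variable at \<open>1/2\<close> makes the integral depend on \<open>\<alpha>\<close> only through its
  absolute value: the reflection \<open>u \<mapsto> 1 - u\<close> changes the sign of \<open>\<alpha>\<close>. This is how the section
  volume becomes a function of the absolute values of the components of the normal vector.
\<close>

lemma has_integral_pos_power_affine:
  assumes "\<alpha> \<noteq> 0"
  shows "((\<lambda>u. pos_power n (x - \<alpha> * (u - 1/2))) has_integral
           (pos_power (Suc n) (x + \<bar>\<alpha>\<bar> / 2) - pos_power (Suc n) (x - \<bar>\<alpha>\<bar> / 2)) / ((1 + real n) * \<bar>\<alpha>\<bar>)) {0..1}"
proof -
  define G where "G = (\<lambda>u. - pos_power (Suc n) (x - \<alpha> * (u - 1/2)) / ((1 + real n) * \<alpha>))"
  have "((\<lambda>u. pos_power n (x - \<alpha> * (u - 1/2))) has_integral (G 1 - G 0)) {0..1}"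
  proof (rule fundamental_theorem_of_calculus_strong[of "{1/2 + x / \<alpha>}"])
    have "continuous_on {0..1} (\<lambda>u. pos_power (Suc n) (x - \<alpha> * (u - 1/2)))"
      by (rule continuous_on_compose2[OF continuous_on_pos_power[of "Suc n" UNIV]])
         (auto intro!: continuous_intros)
    thus "continuous_on {0..1} G"
      unfolding G_def using assms by (intro continuous_intros) auto
  next
    fix u assume u: "u \<in> {0..1} - {1/2 + x / \<alpha>}"
    have "x - \<alpha> * (u - 1/2) \<noteq> 0"
    proof
      assume "x - \<alpha> * (u - 1/2) = 0"
      hence "u = 1/2 + x / \<alpha>" using assms by (simp add: field_simps)
      thus False using u by simp
    qed
    hence "((\<lambda>u. pos_power (Suc n) (x - \<alpha> * (u - 1/2))) has_field_derivative
        ((1 + real n) * pos_power n (x - \<alpha> * (u - 1/2))) * (- \<alpha>)) (at u)"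
      by (intro DERIV_chain2[OF has_field_derivative_pos_power])
         (auto intro!: derivative_eq_intros)
    hence "(G has_field_derivative - (((1 + real n) * pos_power n (x - \<alpha> * (u - 1/2))) * (- \<alpha>))
        / ((1 + real n) * \<alpha>)) (at u)"
      unfolding G_def by (intro DERIV_cdivide DERIV_minus)
    also have "- (((1 + real n) * y) * (- \<alpha>)) / ((1 + real n) * \<alpha>) = y" for y
      using assms by (simp add: add_nonneg_eq_0_iff)
    finally have "(G has_field_derivative pos_power n (x - \<alpha> * (u - 1/2))) (at u)" .
    thus "(G has_vector_derivative pos_power n (x - \<alpha> * (u - 1/2))) (at u)"
      by (simp add: has_real_derivative_iff_has_vector_derivative)
  qed auto
  also have "G 1 - G 0 = (pos_power (Suc n) (x + \<bar>\<alpha>\<bar> / 2) - pos_power (Suc n) (x - \<bar>\<alpha>\<bar> / 2)) / ((1 + real n) * \<bar>\<alpha>\<bar>)"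
  proof (cases "\<alpha> > 0")
    case True
    hence "G 1 = - pos_power (Suc n) (x - \<bar>\<alpha>\<bar> / 2) / ((1 + real n) * \<bar>\<alpha>\<bar>)"
      "G 0 = - pos_power (Suc n) (x + \<bar>\<alpha>\<bar> / 2) / ((1 + real n) * \<bar>\<alpha>\<bar>)"
      by (simp_all add: G_def)
    thus ?thesis by (simp add: diff_divide_distrib)
  next
    case False
    \<comment> \<open>the orientation of the interval is reversed, and so are the roles of \<open>G 0\<close> and \<open>G 1\<close>\<close>
    then obtain \<beta> where \<beta>: "\<alpha> = - \<beta>" "0 < \<beta>" "\<bar>\<alpha>\<bar> = \<beta>"
      using assms that[of "- \<alpha>"] by linarith
    hence "G 1 = pos_power (Suc n) (x + \<beta> / 2) / ((1 + real n) * \<beta>)"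
      "G 0 = pos_power (Suc n) (x - \<beta> / 2) / ((1 + real n) * \<beta>)"
      by (simp_all add: G_def)
    thus ?thesis by (simp add: diff_divide_distrib \<beta>(3))
  qed
  finally show ?thesis .
qed

text \<open>
  The terms belong to the vertices of the cube: for \<open>\<alpha> \<ge> 0\<close> the argument of \<open>pos_power\<close> is \<open>s\<close>
  minus the value of \<open>c \<mapsto> \<Sum>j\<in>J. \<alpha> j * (c j - 1/2)\<close> at the vertex with coordinates 1 exactly on \<open>I\<close>.
\<close>

definition signed_vertex_sum :: "('i \<Rightarrow> real) \<Rightarrow> 'i set \<Rightarrow> nat \<Rightarrow> real \<Rightarrow> real" where
  "signed_vertex_sum \<alpha> J n s =
     (\<Sum>I\<in>Pow J. (-1) ^ card I * pos_power n (s + (\<Sum>j\<in>J. \<bar>\<alpha> j\<bar>) / 2 - (\<Sum>j\<in>I. \<bar>\<alpha> j\<bar>)))"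

text \<open>
  Adding a dimension turns the sum into a central difference with step \<open>|\<alpha> k|\<close>, which is the
  shape of the integral in \<open>has_integral_pos_power_affine\<close>.
\<close>

lemma signed_vertex_sum_insert:
  assumes "finite J" "k \<notin> J"
  shows "signed_vertex_sum \<alpha> (insert k J) n s = signed_vertex_sum \<alpha> J n (s + \<bar>\<alpha> k\<bar> / 2) - signed_vertex_sum \<alpha> J n (s - \<bar>\<alpha> k\<bar> / 2)"
proof -
  have inj: "inj_on (insert k) (Pow J)"
    using assms(2) by (auto simp: inj_on_def)
  have disj: "Pow J \<inter> insert k ` Pow J = {}" using assms(2) by auto
  define f where "f = (\<lambda>I. (-1) ^ card I * pos_power n (s + (\<Sum>j\<in>insert k J. \<bar>\<alpha> j\<bar>) / 2 - (\<Sum>j\<in>I. \<bar>\<alpha> j\<bar>)))"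
  have "signed_vertex_sum \<alpha> (insert k J) n s = sum f (Pow J) + sum f (insert k ` Pow J)"
    unfolding signed_vertex_sum_def f_def[symmetric] Pow_insert
    using assms disj by (intro sum.union_disjoint) auto
  also have "sum f (insert k ` Pow J) = (\<Sum>I\<in>Pow J. f (insert k I))"
    by (simp add: sum.reindex[OF inj])
  also have "(\<Sum>I\<in>Pow J. f (insert k I)) = - signed_vertex_sum \<alpha> J n (s - \<bar>\<alpha> k\<bar> / 2)"
    unfolding signed_vertex_sum_def sum_negf[symmetric]
  proof (rule sum.cong)
    fix I assume "I \<in> Pow J"
    hence "finite I" "k \<notin> I" using assms finite_subset by auto
    thus "f (insert k I) = - ((-1) ^ card I * pos_power n (s - \<bar>\<alpha> k\<bar> / 2 + (\<Sum>j\<in>J. \<bar>\<alpha> j\<bar>) / 2 - (\<Sum>j\<in>I. \<bar>\<alpha> j\<bar>)))"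
      using assms by (simp add: f_def field_simps)
  qed simp
  also have "sum f (Pow J) = signed_vertex_sum \<alpha> J n (s + \<bar>\<alpha> k\<bar> / 2)"
    using assms by (simp add: f_def signed_vertex_sum_def add_divide_distrib algebra_simps)
  finally show ?thesis by simp
qed

lemma measurable_signed_vertex_sum [measurable]: "signed_vertex_sum \<alpha> J n \<in> borel_measurable borel"
  unfolding signed_vertex_sum_def by measurable

lemma has_integral_signed_vertex_sum:
  assumes "finite J" "k \<notin> J" "\<alpha> k \<noteq> 0"
  shows "((\<lambda>u. signed_vertex_sum \<alpha> J n (s - \<alpha> k * (u - 1/2))) has_integral
           signed_vertex_sum \<alpha> (insert k J) (Suc n) s / ((1 + real n) * \<bar>\<alpha> k\<bar>)) {0..1}"
proof -
  define c where "c I = s + (\<Sum>j\<in>J. \<bar>\<alpha> j\<bar>) / 2 - (\<Sum>j\<in>I. \<bar>\<alpha> j\<bar>)" for I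
  have "((\<lambda>u. \<Sum>I\<in>Pow J. (-1) ^ card I * pos_power n (c I - \<alpha> k * (u - 1/2))) has_integral
     (\<Sum>I\<in>Pow J. (-1) ^ card I * ((pos_power (Suc n) (c I + \<bar>\<alpha> k\<bar> / 2) - pos_power (Suc n) (c I - \<bar>\<alpha> k\<bar> / 2)) / ((1 + real n) * \<bar>\<alpha> k\<bar>)))) {0..1}"
    using assms by (intro has_integral_sum has_integral_mult_right has_integral_pos_power_affine) auto
  moreover have "(\<lambda>u. \<Sum>I\<in>Pow J. (-1) ^ card I * pos_power n (c I - \<alpha> k * (u - 1/2)))
      = (\<lambda>u. signed_vertex_sum \<alpha> J n (s - \<alpha> k * (u - 1/2)))"
    unfolding signed_vertex_sum_def c_def by (intro ext sum.cong refl) (simp add: algebra_simps)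
  moreover have "(\<Sum>I\<in>Pow J. (-1) ^ card I * ((pos_power (Suc n) (c I + \<bar>\<alpha> k\<bar> / 2) - pos_power (Suc n) (c I - \<bar>\<alpha> k\<bar> / 2)) / ((1 + real n) * \<bar>\<alpha> k\<bar>)))
      = signed_vertex_sum \<alpha> (insert k J) (Suc n) s / ((1 + real n) * \<bar>\<alpha> k\<bar>)"
    unfolding signed_vertex_sum_insert[OF assms(1,2)] unfolding signed_vertex_sum_def c_def sum_subtractf[symmetric] sum_divide_distrib
    by (intro sum.cong refl) (simp add: algebra_simps diff_divide_distrib)
  ultimately show ?thesis by simp
qed

definition cube_halfspace :: "('i \<Rightarrow> real) \<Rightarrow> 'i set \<Rightarrow> real \<Rightarrow> ('i \<Rightarrow> real) set" where
  "cube_halfspace \<alpha> J s = {c \<in> PiE J (\<lambda>_. {0..1}). (\<Sum>j\<in>J. \<alpha> j * (c j - 1/2)) \<le> s}"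

lemma sets_cube_halfspace [measurable]:
  assumes "finite J"
  shows "cube_halfspace \<alpha> J s \<in> sets (PiM J (\<lambda>_. lborel))"
  unfolding cube_halfspace_def using assms by (rule sets_unit_box_Collect) measurable

text \<open>
  Induction over the dimension: fixing the new coordinate \<open>u\<close> leaves a halfspace section of the
  smaller cube, at level \<open>s - \<alpha> k * (u - 1/2)\<close>, and integration over \<open>u\<close> raises the exponent of the
  truncated powers by one. Nonnegativity is carried along because \<open>ennreal\<close> truncates negative
  numbers.
\<close>

lemma emeasure_cube_halfspace:
  assumes "finite J" "\<And>j. j \<in> J \<Longrightarrow> \<alpha> j \<noteq> 0"
  defines "V \<equiv> \<lambda>J s. signed_vertex_sum \<alpha> J (card J) s / (fact (card J) * (\<Prod>j\<in>J. \<bar>\<alpha> j\<bar>))"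
  shows "0 \<le> V J s \<and> emeasure (PiM J (\<lambda>_. lborel)) (cube_halfspace \<alpha> J s) = ennreal (V J s)"
  using assms(1,2)
proof (induction J arbitrary: s rule: finite_induct)
  case empty
  have "cube_halfspace \<alpha> {} s = (if 0 \<le> s then {\<lambda>_. undefined} else {})"
    by (simp add: cube_halfspace_def)
  thus ?case by (simp add: V_def signed_vertex_sum_def pos_power_def)
next
  case (insert k J)
  interpret product_sigma_finite "\<lambda>_. lborel :: real measure" by standard
  note IH = insert.IH[OF insert.prems, simplified]
  have \<alpha>: "\<alpha> k \<noteq> 0" using insert.prems by simp
  have [measurable]: "V J \<in> borel_measurable borel" unfolding V_def by measurable
  have int: "((\<lambda>u. V J (s - \<alpha> k * (u - 1/2))) has_integral V (insert k J) s) {0..1}"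
  proof -
    have "((\<lambda>u. signed_vertex_sum \<alpha> J (card J) (s - \<alpha> k * (u - 1/2)) / (fact (card J) * (\<Prod>j\<in>J. \<bar>\<alpha> j\<bar>))) has_integral
           signed_vertex_sum \<alpha> (insert k J) (Suc (card J)) s / ((1 + real (card J)) * \<bar>\<alpha> k\<bar>) / (fact (card J) * (\<Prod>j\<in>J. \<bar>\<alpha> j\<bar>))) {0..1}"
      by (intro has_integral_divide has_integral_signed_vertex_sum insert.hyps \<alpha>)
    thus ?thesis using insert.hyps by (simp add: V_def mult_ac)
  qed
  have nonneg: "0 \<le> V (insert k J) s"
    using IH by (intro has_integral_nonneg[OF int]) auto
  let ?P = "\<lambda>J. PiM J (\<lambda>_. lborel :: real measure)"
  have slice: "indicator (cube_halfspace \<alpha> (insert k J) s) (c(k := u))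
      = (indicator {0..1} u * indicator (cube_halfspace \<alpha> J (s - \<alpha> k * (u - 1/2))) c :: ennreal)"
    if "c \<in> space (?P J)" for c u
  proof -
    have "(\<Sum>j\<in>J. \<alpha> j * ((c(k := u)) j - 1/2)) = (\<Sum>j\<in>J. \<alpha> j * (c j - 1/2))"
      using insert.hyps by (intro sum.cong) auto
    thus ?thesis
      using insert.hyps that
      by (auto simp: cube_halfspace_def indicator_def space_PiM PiE_iff extensional_def split: if_splits)
  qed
  have meas: "cube_halfspace \<alpha> (insert k J) s \<in> sets (?P (insert k J))"
    using insert.hyps by (intro sets_cube_halfspace) auto
  have "emeasure (?P (insert k J)) (cube_halfspace \<alpha> (insert k J) s)
      = (\<integral>\<^sup>+ c. indicator (cube_halfspace \<alpha> (insert k J) s) c \<partial>?P (insert k J))"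
    using meas by simp
  also have "\<dots> = (\<integral>\<^sup>+ u. \<integral>\<^sup>+ c. indicator (cube_halfspace \<alpha> (insert k J) s) (c(k := u)) \<partial>?P J \<partial>lborel)"
    using insert.hyps meas by (intro product_nn_integral_insert_rev) auto
  also have "\<dots> = (\<integral>\<^sup>+ u. indicator {0..1} u * ennreal (V J (s - \<alpha> k * (u - 1/2))) \<partial>lborel)"
  proof (rule nn_integral_cong)
    fix u :: real
    have "(\<integral>\<^sup>+ c. indicator (cube_halfspace \<alpha> (insert k J) s) (c(k := u)) \<partial>?P J)
       = (\<integral>\<^sup>+ c. indicator {0..1} u * indicator (cube_halfspace \<alpha> J (s - \<alpha> k * (u - 1/2))) c \<partial>?P J)"
      by (intro nn_integral_cong slice)
    also have "\<dots> = indicator {0..1} u * emeasure (?P J) (cube_halfspace \<alpha> J (s - \<alpha> k * (u - 1/2)))"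
      using sets_cube_halfspace[OF insert.hyps(1)] by (subst nn_integral_cmult) auto
    finally show "(\<integral>\<^sup>+ c. indicator (cube_halfspace \<alpha> (insert k J) s) (c(k := u)) \<partial>?P J)
       = indicator {0..1} u * ennreal (V J (s - \<alpha> k * (u - 1/2)))"
      using IH by simp
  qed
  also have "\<dots> = ennreal (V (insert k J) s)"
  proof -
    have "(\<integral>\<^sup>+ u. indicator {0..1} u * ennreal (V J (s - \<alpha> k * (u - 1/2))) \<partial>lborel) =
      (\<integral>\<^sup>+ u. ennreal (indicator {0..1} u * V J (s - \<alpha> k * (u - 1/2))) \<partial>lborel)"
      by (intro nn_integral_cong) (auto simp: indicator_def)
    also have "\<dots> = ennreal (V (insert k J) s)"
      using nn_integral_has_integral_lebesgue[OF _ int] IH by auto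
    finally show ?thesis .
  qed
  finally show ?case using nonneg by simp
qed

text \<open>
  Once the other coordinates are fixed, the coordinate \<open>k\<close> can take at most one value.
\<close>

lemma null_set_cube_hyperplane:
  fixes \<alpha> :: "'i \<Rightarrow> real"
  assumes "finite J" "k \<in> J" "\<alpha> k \<noteq> 0"
  shows "{c \<in> PiE J (\<lambda>_. {0..1}). (\<Sum>j\<in>J. \<alpha> j * (c j - 1/2)) = s} \<in> null_sets (PiM J (\<lambda>_. lborel))" (is "?N \<in> _")
proof -
  interpret product_sigma_finite "\<lambda>_. lborel :: real measure" by standard
  define J' where "J' = J - {k}"
  have J': "finite J'" "k \<notin> J'" "J = insert k J'" using assms by (auto simp: J'_def)
  have N: "?N \<in> sets (PiM J (\<lambda>_. lborel))"
    using assms(1) by (rule sets_unit_box_Collect) measurable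
  have "emeasure (PiM J (\<lambda>_. lborel)) ?N = (\<integral>\<^sup>+ c. indicator ?N c \<partial>PiM J (\<lambda>_. lborel))"
    using N by simp
  also have "\<dots> = (\<integral>\<^sup>+ c. \<integral>\<^sup>+ u. indicator ?N (c(k := u)) \<partial>lborel \<partial>PiM J' (\<lambda>_. lborel))"
    using N unfolding J'(3) by (intro product_nn_integral_insert J'(1,2)) simp
  also have "\<dots> = (\<integral>\<^sup>+ c. 0 \<partial>PiM J' (\<lambda>_. lborel :: real measure))"
  proof (rule nn_integral_cong)
    fix c :: "'i \<Rightarrow> real"
    define r where "r = (s - (\<Sum>j\<in>J'. \<alpha> j * (c j - 1/2))) / \<alpha> k + 1/2"
    have "indicator ?N (c(k := u)) \<le> (indicator {r} u :: ennreal)" for u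
    proof (cases "c(k := u) \<in> ?N")
      case True
      have "(\<Sum>j\<in>J'. \<alpha> j * ((c(k := u)) j - 1/2)) = (\<Sum>j\<in>J'. \<alpha> j * (c j - 1/2))"
        using J'(2) by (intro sum.cong) auto
      hence "\<alpha> k * (u - 1/2) + (\<Sum>j\<in>J'. \<alpha> j * (c j - 1/2)) = s"
        using True J' by simp
      hence "u = r" using assms(3) by (simp add: r_def field_simps)
      thus ?thesis by (simp add: indicator_def)
    qed simp
    hence "(\<integral>\<^sup>+ u. indicator ?N (c(k := u)) \<partial>lborel) \<le> (\<integral>\<^sup>+ u. indicator {r} u \<partial>lborel)"
      by (intro nn_integral_mono)
    thus "(\<integral>\<^sup>+ u. indicator ?N (c(k := u)) \<partial>lborel) = 0" by simp
  qed
  finally show ?thesis using N by (simp add: null_sets_def)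
qed

lemma emeasure_cube_slab:
  fixes \<alpha> :: "'i \<Rightarrow> real"
  assumes J: "finite J" "J \<noteq> {}" and \<alpha>: "\<And>j. j \<in> J \<Longrightarrow> \<alpha> j \<noteq> 0" and "l \<le> u"
  defines "v \<equiv> (signed_vertex_sum \<alpha> J (card J) u - signed_vertex_sum \<alpha> J (card J) l) / (fact (card J) * (\<Prod>j\<in>J. \<bar>\<alpha> j\<bar>))"
  shows "0 \<le> v"
    and "emeasure (PiM J (\<lambda>_. lborel))
           {c \<in> PiE J (\<lambda>_. {0..1}). l \<le> (\<Sum>j\<in>J. \<alpha> j * (c j - 1/2)) \<and> (\<Sum>j\<in>J. \<alpha> j * (c j - 1/2)) \<le> u} = ennreal v"
    (is "emeasure ?P ?S = _")
proof -
  define V where "V = (\<lambda>s. signed_vertex_sum \<alpha> J (card J) s / (fact (card J) * (\<Prod>j\<in>J. \<bar>\<alpha> j\<bar>)))"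
  have V: "0 \<le> V s" "emeasure ?P (cube_halfspace \<alpha> J s) = ennreal (V s)" for s
    using emeasure_cube_halfspace[where s = s, OF J(1) \<alpha>] by (auto simp: V_def)
  have v: "v = V u - V l" by (simp add: v_def V_def diff_divide_distrib)
  have "ennreal (V l) \<le> ennreal (V u)"
    unfolding V(2)[symmetric] using J \<open>l \<le> u\<close>
    by (intro emeasure_mono sets_cube_halfspace) (auto simp: cube_halfspace_def)
  thus "0 \<le> v" using V(1) by (simp add: v)
  \<comment> \<open>the set difference omits the boundary at level \<open>l\<close>, which is a null set\<close>
  define D where "D = cube_halfspace \<alpha> J u - cube_halfspace \<alpha> J l"
  define N where "N = {c \<in> PiE J (\<lambda>_. {0..1}). (\<Sum>j\<in>J. \<alpha> j * (c j - 1/2)) = l}"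
  obtain k where "k \<in> J" using J by auto
  hence N: "N \<in> null_sets ?P"
    unfolding N_def using J \<alpha> by (intro null_set_cube_hyperplane) auto
  have D: "D \<in> sets ?P" unfolding D_def using J by (intro sets.Diff sets_cube_halfspace)
  have "?S = D \<union> N" using \<open>l \<le> u\<close> by (auto simp: D_def N_def cube_halfspace_def)
  hence "emeasure ?P ?S = emeasure ?P D"
    using emeasure_Un_null_set[OF D N] by simp
  also have "\<dots> = ennreal (V u) - ennreal (V l)"
    unfolding D_def V(2)[symmetric] using J \<open>l \<le> u\<close> V(2)[of l]
    by (intro emeasure_Diff) (auto simp: cube_halfspace_def[of _ _ u] cube_halfspace_def[of _ _ l]
          intro: sets_cube_halfspace)
  also have "\<dots> = ennreal (V u - V l)" using V(1) by (simp add: ennreal_minus)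
  finally show "emeasure ?P ?S = ennreal v" by (simp add: v)
qed

section \<open>An explicit formula for the section volume\<close>

lemma signed_vertex_sum_reindex:
  assumes "inj_on f J"
  shows "signed_vertex_sum \<alpha> (f ` J) n s = signed_vertex_sum (\<lambda>j. \<alpha> (f j)) J n s"
proof -
  have "inj_on (image f) (Pow J)" using assms by (rule inj_on_image_Pow)
  moreover have "Pow (f ` J) = image f ` Pow J" by (simp add: image_Pow_surj)
  ultimately have "signed_vertex_sum \<alpha> (f ` J) n s = (\<Sum>I\<in>Pow J. (-1) ^ card (f ` I) *
      pos_power n (s + (\<Sum>j\<in>f ` J. \<bar>\<alpha> j\<bar>) / 2 - (\<Sum>j\<in>f ` I. \<bar>\<alpha> j\<bar>)))"
    unfolding signed_vertex_sum_def by (simp add: sum.reindex)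
  also have "\<dots> = signed_vertex_sum (\<lambda>j. \<alpha> (f j)) J n s"
    unfolding signed_vertex_sum_def
  proof (rule sum.cong)
    fix I assume "I \<in> Pow J"
    hence "inj_on f I" using assms inj_on_subset by blast
    thus "(- 1) ^ card (f ` I) * pos_power n (s + (\<Sum>j\<in>f ` J. \<bar>\<alpha> j\<bar>) / 2 - (\<Sum>j\<in>f ` I. \<bar>\<alpha> j\<bar>)) =
      (- 1) ^ card I * pos_power n (s + (\<Sum>j\<in>J. \<bar>\<alpha> (f j)\<bar>) / 2 - (\<Sum>j\<in>I. \<bar>\<alpha> (f j)\<bar>))"
      using assms by (simp add: card_image sum.reindex)
  qed simp
  finally show ?thesis .
qed

lemma directions_hyperplane:
  fixes a :: "'a::euclidean_space"
  assumes a: "norm a = 1"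
  shows "directions {x. a \<bullet> x = s} = {x. a \<bullet> x = 0}"
proof -
  let ?H = "{x. a \<bullet> x = s}"
  have sub: "subspace {x. a \<bullet> x = 0}" by (rule subspace_hyperplane)
  have aa: "a \<bullet> (s *\<^sub>R a) = s" using a by (simp add: dot_square_norm)
  have "{x - y |x y. x \<in> ?H \<and> y \<in> ?H} = {x. a \<bullet> x = 0}"
  proof (intro set_eqI iffI)
    fix z assume "z \<in> {x. a \<bullet> x = 0}"
    hence "z = (z + s *\<^sub>R a) - s *\<^sub>R a" "a \<bullet> (z + s *\<^sub>R a) = s"
      using aa by (auto simp: inner_add_right)
    thus "z \<in> {x - y |x y. x \<in> ?H \<and> y \<in> ?H}" using aa by blast
  qed (auto simp: inner_diff_right)
  thus ?thesis
    unfolding directions_def using sub by simp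
qed

lemma orthonormal_frame_hyperplane_exists:
  fixes a :: "'a::euclidean_space"
  assumes a: "norm a = 1"
  shows "\<exists>fr. orthonormal_frame {x. a \<bullet> x = s} fr"
proof -
  obtain B where "pairwise orthogonal B" "\<And>b. b \<in> B \<Longrightarrow> norm b = 1" "span B = {x. a \<bullet> x = 0}"
    using orthonormal_basis_subspace[OF subspace_hyperplane[of a]] by metis
  hence "orthonormal_frame {x. a \<bullet> x = s} (s *\<^sub>R a, B)"
    using a by (auto simp: orthonormal_frame_def directions_hyperplane dot_square_norm)
  thus ?thesis ..
qed

text \<open>
  By the two computations of the prism volume in direction \<open>e\<close>, \<open>|a \<bullet> e|\<close> times the volume of the
  section is the volume of a slab of half-width \<open>|a \<bullet> e| / 2\<close> in the remaining coordinates. The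
  difference of the two halfspace volumes is again a sum over vertices, now of the full cube.
\<close>

lemma affine_volume_hyperplane_cbox:
  fixes a :: "'a::euclidean_space" and t :: real
  assumes a: "norm a = 1" and a_nz: "\<And>b. b \<in> Basis \<Longrightarrow> a \<bullet> b \<noteq> 0" and dim: "2 \<le> DIM('a)"
  defines "H \<equiv> {x. a \<bullet> x = a \<bullet> One / 2 - t}"
  shows "affine_volume H (H \<inter> cbox 0 One)
       = signed_vertex_sum (\<lambda>b. a \<bullet> b) Basis (DIM('a) - 1) (- t) / (fact (DIM('a) - 1) * (\<Prod>b\<in>Basis. \<bar>a \<bullet> b\<bar>))"
proof -
  define s where "s = a \<bullet> One / 2 - t"
  have H: "H = {x. a \<bullet> x = s}" by (simp add: H_def s_def)
  obtain p B where pB: "(SOME fr. orthonormal_frame H fr) = (p, B)" by fastforce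
  have "orthonormal_frame H (p, B)"
    using someI_ex[OF orthonormal_frame_hyperplane_exists[OF a, of s]] unfolding H pB[unfolded H] .
  hence ap: "a \<bullet> p = s"
    and B': "pairwise orthogonal B" "\<And>b. b \<in> B \<Longrightarrow> norm b = 1" "span B = {x. a \<bullet> x = 0}"
    by (auto simp: orthonormal_frame_def H directions_hyperplane[OF a])
  note B = pairwise_orthogonal_imp_finite[OF B'(1)] B'
  define K where "K = {c \<in> extensional B. p + (\<Sum>b\<in>B. c b *\<^sub>R b) \<in> cbox 0 One}"
  have "p + (\<Sum>b\<in>B. c b *\<^sub>R b) \<in> H" for c
  proof -
    have "(\<Sum>b\<in>B. c b *\<^sub>R b) \<in> span B" by (intro span_sum span_mul span_base)
    thus ?thesis using ap B'(3) by (simp add: H_def s_def inner_add_right)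
  qed
  hence vol: "affine_volume H (H \<inter> cbox 0 One) = measure (PiM B (\<lambda>_. lborel)) K"
    by (simp add: affine_volume_def pB K_def)
  obtain e :: 'a where e: "e \<in> Basis" using nonempty_Basis by blast
  have ae: "a \<bullet> e \<noteq> 0" using a_nz e by blast
  define J where "J = (Basis :: 'a set) - {e}"
  have J: "finite J" "e \<notin> J" "insert e J = Basis" using e by (auto simp: J_def)
  have cardJ: "card J = DIM('a) - 1" using e by (simp add: J_def)
  hence "J \<noteq> {}" using dim by auto
  define h where "h = \<bar>a \<bullet> e\<bar> / 2"
  define R where "R = (signed_vertex_sum (\<lambda>b. a \<bullet> b) J (card J) (- t + h) - signed_vertex_sum (\<lambda>b. a \<bullet> b) J (card J) (- t - h))
      / (fact (card J) * (\<Prod>b\<in>J. \<bar>a \<bullet> b\<bar>))"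
  have "ennreal \<bar>a \<bullet> e\<bar> * emeasure (PiM B (\<lambda>_. lborel)) K
      = emeasure lborel {x. a \<bullet> (x - p) / (a \<bullet> e) \<in> {0..1} \<and> x - (a \<bullet> (x - p) / (a \<bullet> e)) *\<^sub>R e \<in> cbox 0 One}"
    unfolding K_def by (rule emeasure_oblique_prism[OF a ae B, symmetric]) (auto intro: borel_closed closed_cbox)
  also have "\<dots> = emeasure lborel {x. (a \<bullet> x - s) / (a \<bullet> e) \<in> {0..1} \<and> x - ((a \<bullet> x - s) / (a \<bullet> e)) *\<^sub>R e \<in> cbox 0 One}"
    by (simp only: inner_diff_right ap)
  also have "\<dots> = emeasure (PiM J (\<lambda>_. lborel)) {c \<in> PiE J (\<lambda>_. {0..1}).
      (s - (\<Sum>b\<in>J. (a \<bullet> b) * c b)) / (a \<bullet> e) \<in> {0..1}}"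
    unfolding J_def by (rule emeasure_prism_along_axis[OF e ae])
  also have "{c \<in> PiE J (\<lambda>_. {0..1}). (s - (\<Sum>b\<in>J. (a \<bullet> b) * c b)) / (a \<bullet> e) \<in> {0..1}}
      = {c \<in> PiE J (\<lambda>_. {0..1}). - t - h \<le> (\<Sum>b\<in>J. (a \<bullet> b) * (c b - 1/2)) \<and> (\<Sum>b\<in>J. (a \<bullet> b) * (c b - 1/2)) \<le> - t + h}"
  proof (intro Collect_cong conj_cong refl)
    fix c :: "'a \<Rightarrow> real"
    define y where "y = (\<Sum>b\<in>J. (a \<bullet> b) * (c b - 1/2))"
    have "a \<bullet> One = a \<bullet> e + (\<Sum>b\<in>J. a \<bullet> b)"
      unfolding J(3)[symmetric] using J(1,2) by (simp add: inner_add_right inner_sum_right)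
    hence "s - (\<Sum>b\<in>J. (a \<bullet> b) * c b) = (a \<bullet> e) / 2 - t - y"
      by (simp add: s_def y_def right_diff_distrib sum_subtractf sum_divide_distrib[symmetric])
    thus "(s - (\<Sum>b\<in>J. (a \<bullet> b) * c b)) / (a \<bullet> e) \<in> {0..1} \<longleftrightarrow> - t - h \<le> y \<and> y \<le> - t + h"
      using ae by (cases "a \<bullet> e > 0") (auto simp: h_def divide_simps)
  qed
  also have "emeasure (PiM J (\<lambda>_. lborel)) \<dots> = ennreal R"
    unfolding R_def using a_nz J \<open>J \<noteq> {}\<close>
    by (intro emeasure_cube_slab(2)) (auto simp: h_def)
  finally have eq: "ennreal \<bar>a \<bullet> e\<bar> * emeasure (PiM B (\<lambda>_. lborel)) K = ennreal R" .
  have "R \<ge> 0"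
    unfolding R_def using a_nz J \<open>J \<noteq> {}\<close>
    by (intro emeasure_cube_slab(1)) (auto simp: h_def)
  have "\<bar>a \<bullet> e\<bar> * measure (PiM B (\<lambda>_. lborel)) K = R"
    using arg_cong[OF eq, of enn2real] \<open>R \<ge> 0\<close> by (simp add: measure_def enn2real_mult)
  hence "measure (PiM B (\<lambda>_. lborel)) K = R / \<bar>a \<bullet> e\<bar>" using ae by (simp add: field_simps)
  also have "\<dots> = signed_vertex_sum (\<lambda>b. a \<bullet> b) (insert e J) (card J) (- t) / (fact (card J) * (\<Prod>b\<in>insert e J. \<bar>a \<bullet> b\<bar>))"
    using J(1,2) by (simp add: R_def h_def signed_vertex_sum_insert mult_ac)
  finally show ?thesis unfolding vol J(3) cardJ .
qed

lemma section_volume_formula: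
  fixes a :: "real^'n"
  assumes a: "norm a = 1" and a_nz: "\<And>i. a $ i \<noteq> 0" and dim: "2 \<le> CARD('n)"
  shows "section_volume t a
       = signed_vertex_sum (($) a) UNIV (CARD('n) - 1) (- t) / (fact (CARD('n) - 1) * (\<Prod>i\<in>UNIV. \<bar>a $ i\<bar>))"
proof -
  let ?ax = "\<lambda>i::'n. axis i (1::real)"
  have inj: "inj ?ax" by (auto simp: inj_on_def axis_eq_axis)
  have Basis: "(Basis :: (real^'n) set) = range ?ax" by (auto simp: Basis_vec_def)
  have One: "a \<bullet> One = (\<Sum>i\<in>UNIV. a $ i)"
    unfolding Basis inner_sum_right sum.reindex[OF inj] by (simp add: inner_axis)
  have cube: "unit_cube = cbox 0 (One :: real^'n)"
  proof -
    have "unit_cube = {x :: real^'n. \<forall>b\<in>Basis. 0 \<le> x \<bullet> b \<and> x \<bullet> b \<le> 1}"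
      by (auto simp: unit_cube_def Basis inner_axis)
    thus ?thesis by (auto simp: mem_box)
  qed
  have "section_volume t a = affine_volume {x. a \<bullet> x = a \<bullet> One / 2 - t} ({x. a \<bullet> x = a \<bullet> One / 2 - t} \<inter> cbox 0 One)"
    by (simp add: section_volume_def hyperplane_at_def cube One)
  also have "\<dots> = signed_vertex_sum (\<lambda>b. a \<bullet> b) Basis (CARD('n) - 1) (- t) / (fact (CARD('n) - 1) * (\<Prod>b\<in>Basis. \<bar>a \<bullet> b\<bar>))"
  proof -
    have "a \<bullet> b \<noteq> 0" if "b \<in> Basis" for b
      using that a_nz by (auto simp: Basis inner_axis)
    thus ?thesis using affine_volume_hyperplane_cbox[OF a] dim by simp
  qed
  also have "\<dots> = signed_vertex_sum (($) a) UNIV (CARD('n) - 1) (- t) / (fact (CARD('n) - 1) * (\<Prod>i\<in>UNIV. \<bar>a $ i\<bar>))"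
    unfolding Basis signed_vertex_sum_reindex[OF inj] prod.reindex[OF inj] by (simp add: inner_axis)
  finally show ?thesis .
qed

section \<open>Symmetric sums over subsets\<close>

lemma sum_Pow_card:
  fixes \<phi> :: "nat \<Rightarrow> real"
  assumes "finite J"
  shows "(\<Sum>I\<in>Pow J. \<phi> (card I)) = (\<Sum>i\<le>card J. real (card J choose i) * \<phi> i)"
proof -
  have "(\<Sum>I\<in>Pow J. \<phi> (card I)) = (\<Sum>i\<le>card J. \<Sum>I\<in>{I \<in> Pow J. card I = i}. \<phi> (card I))"
    using assms by (intro sum.group[symmetric]) (auto intro: card_mono)
  also have "\<dots> = (\<Sum>i\<le>card J. real (card J choose i) * \<phi> i)"
    using n_subsets[OF assms] by (intro sum.cong) auto
  finally show ?thesis .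
qed

lemma sum_Pow_card_containing:
  fixes \<phi> :: "nat \<Rightarrow> real"
  assumes "finite J" "j \<in> J"
  shows "(\<Sum>I\<in>Pow J. if j \<in> I then \<phi> (card I) else 0)
       = (\<Sum>i\<le>card J - 1. real ((card J - 1) choose i) * \<phi> (Suc i))"
proof -
  have "bij_betw (insert j) (Pow (J - {j})) {I \<in> Pow J. j \<in> I}"
    using assms(2) by (intro bij_betwI[where g = "\<lambda>I. I - {j}"]) auto
  hence "(\<Sum>I\<in>{I \<in> Pow J. j \<in> I}. \<phi> (card I)) = (\<Sum>I\<in>Pow (J - {j}). \<phi> (card (insert j I)))"
    by (rule sum.reindex_bij_betw[symmetric])
  also have "\<dots> = (\<Sum>I\<in>Pow (J - {j}). \<phi> (Suc (card I)))"
  proof (intro sum.cong refl)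
    fix I assume "I \<in> Pow (J - {j})"
    hence "finite I" "j \<notin> I" using assms(1) finite_subset by auto
    thus "\<phi> (card (insert j I)) = \<phi> (Suc (card I))" by simp
  qed
  also have "\<dots> = (\<Sum>i\<le>card J - 1. real ((card J - 1) choose i) * \<phi> (Suc i))"
    using sum_Pow_card[of "J - {j}" "\<lambda>i. \<phi> (Suc i)"] assms by simp
  finally show ?thesis
    using assms(1) by (simp add: sum.If_cases Int_def)
qed

lemma sum_Pow_card_separating:
  fixes \<phi> :: "nat \<Rightarrow> real"
  assumes "finite J" "j \<in> J" "k \<in> J" "j \<noteq> k"
  shows "(\<Sum>I\<in>Pow J. if j \<in> I \<and> k \<notin> I then \<phi> (card I) else 0)
       = (\<Sum>i\<le>card J - 2. real ((card J - 2) choose i) * \<phi> (Suc i))"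
proof -
  have "{I \<in> Pow J. k \<notin> I} = Pow (J - {k})" by auto
  moreover have "(\<Sum>I\<in>Pow J. if j \<in> I \<and> k \<notin> I then \<phi> (card I) else 0)
      = (\<Sum>I\<in>{I \<in> Pow J. k \<notin> I}. if j \<in> I then \<phi> (card I) else 0)"
    using assms(1) by (intro sum.mono_neutral_cong_right) auto
  ultimately show ?thesis
    using sum_Pow_card_containing[of "J - {k}" j \<phi>] assms by (simp add: numeral_2_eq_2)
qed

text \<open>
  The coefficient of \<open>v j\<close> is the sum of \<open>\<phi> (card I)\<close> over the sets \<open>I\<close> containing \<open>j\<close>, which does not
  depend on \<open>j\<close>.
\<close>

lemma sum_Pow_card_linear:
  fixes \<phi> :: "nat \<Rightarrow> real" and v :: "'i \<Rightarrow> real"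
  assumes J: "finite J" and v: "(\<Sum>j\<in>J. v j) = 0"
  shows "(\<Sum>I\<in>Pow J. \<phi> (card I) * (\<Sum>j\<in>I. v j)) = 0"
proof -
  have "(\<Sum>I\<in>Pow J. \<phi> (card I) * (\<Sum>j\<in>I. v j))
      = (\<Sum>I\<in>Pow J. \<Sum>j\<in>J. v j * (if j \<in> I then \<phi> (card I) else 0))"
  proof (rule sum.cong)
    fix I assume "I \<in> Pow J"
    thus "\<phi> (card I) * (\<Sum>j\<in>I. v j) = (\<Sum>j\<in>J. v j * (if j \<in> I then \<phi> (card I) else 0))"
      using J by (simp add: sum_distrib_right mult.commute if_distrib[of "\<lambda>x. _ * x"] sum.If_cases Int_absorb1 cong: if_cong)
  qed simp
  also have "\<dots> = (\<Sum>j\<in>J. v j * (\<Sum>I\<in>Pow J. if j \<in> I then \<phi> (card I) else 0))"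
    by (subst sum.swap) (simp add: sum_distrib_left)
  also have "\<dots> = (\<Sum>j\<in>J. v j * (\<Sum>i\<le>card J - 1. real ((card J - 1) choose i) * \<phi> (Suc i)))"
    using J by (intro sum.cong) (simp_all add: sum_Pow_card_containing)
  also have "\<dots> = 0" by (simp add: sum_distrib_right[symmetric] v)
  finally show ?thesis .
qed

text \<open>
  The coefficient of \<open>v j * v k\<close> takes one value \<open>A\<close> on the diagonal and one value \<open>A - B\<close> off it,
  where \<open>B\<close> sums over the sets that contain \<open>j\<close> but not \<open>k\<close>. A quadratic form of this kind is
  \<open>(A - B) (\<Sum>j. v j)\<^sup>2 + B (\<Sum>j. (v j)\<^sup>2)\<close>.
\<close>

lemma sum_Pow_card_quadratic:
  fixes \<phi> :: "nat \<Rightarrow> real" and v :: "'i \<Rightarrow> real"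
  assumes J: "finite J" and v: "(\<Sum>j\<in>J. v j) = 0"
  shows "(\<Sum>I\<in>Pow J. \<phi> (card I) * (\<Sum>j\<in>I. v j)\<^sup>2)
       = (\<Sum>j\<in>J. (v j)\<^sup>2) * (\<Sum>i\<le>card J - 2. real ((card J - 2) choose i) * \<phi> (Suc i))"
proof -
  define A where "A = (\<Sum>i\<le>card J - 1. real ((card J - 1) choose i) * \<phi> (Suc i))"
  define B where "B = (\<Sum>i\<le>card J - 2. real ((card J - 2) choose i) * \<phi> (Suc i))"
  have pair: "(\<Sum>I\<in>Pow J. if j \<in> I \<and> k \<in> I then \<phi> (card I) else 0) = A - (if j = k then 0 else B)"
    if "j \<in> J" "k \<in> J" for j k
  proof (cases "j = k")
    case False
    have "(\<Sum>I\<in>Pow J. if j \<in> I \<and> k \<in> I then \<phi> (card I) else 0)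
        = (\<Sum>I\<in>Pow J. (if j \<in> I then \<phi> (card I) else 0) - (if j \<in> I \<and> k \<notin> I then \<phi> (card I) else 0))"
      by (intro sum.cong) auto
    thus ?thesis
      using False that J by (simp add: sum_subtractf sum_Pow_card_containing sum_Pow_card_separating A_def B_def)
  qed (use that J in \<open>simp add: sum_Pow_card_containing A_def\<close>)
  have "(\<Sum>I\<in>Pow J. \<phi> (card I) * (\<Sum>j\<in>I. v j)\<^sup>2)
      = (\<Sum>I\<in>Pow J. \<Sum>j\<in>J. \<Sum>k\<in>J. v j * v k * (if j \<in> I \<and> k \<in> I then \<phi> (card I) else 0))"
  proof (rule sum.cong)
    fix I assume "I \<in> Pow J"
    hence *: "(\<Sum>j\<in>I. v j) = (\<Sum>j\<in>J. if j \<in> I then v j else 0)"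
      using J by (simp add: sum.If_cases Int_absorb1)
    have "\<phi> (card I) * (\<Sum>j\<in>I. v j)\<^sup>2
        = (\<Sum>j\<in>J. \<Sum>k\<in>J. \<phi> (card I) * ((if j \<in> I then v j else 0) * (if k \<in> I then v k else 0)))"
      unfolding * power2_eq_square sum_product unfolding sum_distrib_left ..
    also have "\<dots> = (\<Sum>j\<in>J. \<Sum>k\<in>J. v j * v k * (if j \<in> I \<and> k \<in> I then \<phi> (card I) else 0))"
      by (intro sum.cong refl) auto
    finally show "\<phi> (card I) * (\<Sum>j\<in>I. v j)\<^sup>2 = \<dots>" .
  qed simp
  also have "\<dots> = (\<Sum>j\<in>J. \<Sum>I\<in>Pow J. \<Sum>k\<in>J. v j * v k * (if j \<in> I \<and> k \<in> I then \<phi> (card I) else 0))"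
    by (rule sum.swap)
  also have "\<dots> = (\<Sum>j\<in>J. \<Sum>k\<in>J. v j * v k * (\<Sum>I\<in>Pow J. if j \<in> I \<and> k \<in> I then \<phi> (card I) else 0))"
    by (intro sum.cong refl, subst sum.swap) (simp add: sum_distrib_left)
  also have "\<dots> = (\<Sum>j\<in>J. \<Sum>k\<in>J. v j * v k * (A - B) + (if j = k then v j * v k * B else 0))"
    by (intro sum.cong refl) (simp add: pair algebra_simps)
  also have "\<dots> = (\<Sum>j\<in>J. \<Sum>k\<in>J. v j * v k * (A - B)) + (\<Sum>j\<in>J. v j * v j * B)"
    using J by (simp add: sum.distrib)
  also have "(\<Sum>j\<in>J. \<Sum>k\<in>J. v j * v k * (A - B)) = (\<Sum>j\<in>J. v j) * (\<Sum>k\<in>J. v k) * (A - B)"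
    unfolding sum_product unfolding sum_distrib_right ..
  also have "\<dots> + (\<Sum>j\<in>J. v j * v j * B) = (\<Sum>j\<in>J. (v j)\<^sup>2) * B"
    by (simp add: v sum_distrib_right power2_eq_square)
  finally show ?thesis by (simp add: B_def)
qed

lemma sum_binomial_shift2:
  fixes \<phi> :: "nat \<Rightarrow> real"
  assumes "2 \<le> d"
  shows "(\<Sum>i\<le>d - 2. real ((d - 2) choose i) * \<phi> (Suc i))
       = (\<Sum>i\<le>d. real (d choose i) * (real i * (real d - real i) / (real d * (real d - 1))) * \<phi> i)"
proof -
  obtain m where d: "d = Suc (Suc m)"
    using assms by (metis Suc_diff_Suc Suc_1 diff_zero less_eq_Suc_le Suc_le_lessD le_add_diff_inverse plus_1_eq_Suc add_Suc)
  have "real (d choose Suc i) * (real (Suc i) * (real d - real (Suc i)) / (real d * (real d - 1))) = real (m choose i)"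
    if "i \<le> m" for i
  proof -
    have "real (d choose Suc i) * real (Suc i) = real d * real (Suc m choose i)"
      using Suc_times_binomial[of i "Suc m"] unfolding d by (metis mult.commute of_nat_mult)
    moreover have "real (Suc m choose i) * (real d - real (Suc i)) = (real d - 1) * real (m choose i)"
    proof -
      have "(Suc m - i) * (Suc m choose i) = Suc m * (m choose i)"
        using binomial_absorb_comp[of "Suc m" i] by simp
      hence "real (Suc m - i) * real (Suc m choose i) = real (Suc m) * real (m choose i)"
        by (metis of_nat_mult)
      thus ?thesis using that by (simp add: d of_nat_diff algebra_simps)
    qed
    ultimately have "real (d choose Suc i) * (real (Suc i) * (real d - real (Suc i)))
        = real d * (real d - 1) * real (m choose i)"
      by (metis mult.assoc)
    moreover have "real d * (real d - 1) \<noteq> 0" by (simp add: d)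
    ultimately show ?thesis by (metis nonzero_mult_div_cancel_left times_divide_eq_right)
  qed
  hence "(\<Sum>i\<le>m. real (m choose i) * \<phi> (Suc i))
      = (\<Sum>i\<le>m. real (d choose Suc i) * (real (Suc i) * (real d - real (Suc i)) / (real d * (real d - 1))) * \<phi> (Suc i))"
    by (intro sum.cong) auto
  also have "\<dots> = (\<Sum>i\<le>d. real (d choose i) * (real i * (real d - real i) / (real d * (real d - 1))) * \<phi> i)"
    unfolding d sum.atMost_Suc_shift[of _ "Suc m"] by (simp add: sum.atMost_Suc[of _ m])
  finally show ?thesis by (simp add: d)
qed

text \<open>
  Taylor's theorem with the remainder written as \<open>\<eta> h * h\<^sup>2\<close>, an equation valid for every \<open>h\<close>. Only
  the behaviour of \<open>\<eta>\<close> at 0 depends on \<open>f\<close> being twice continuously differentiable near \<open>x\<close>.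
\<close>

lemma second_order_Taylor:
  fixes f f' f'' :: "real \<Rightarrow> real"
  assumes "0 < e"
    and f': "\<And>y. \<bar>y - x\<bar> < e \<Longrightarrow> (f has_field_derivative f' y) (at y)"
    and f'': "\<And>y. \<bar>y - x\<bar> < e \<Longrightarrow> (f' has_field_derivative f'' y) (at y)"
    and cont: "isCont f'' x"
  obtains \<eta> where "\<eta> \<midarrow>0\<rightarrow> 0" "\<eta> 0 = 0" "\<And>h. f (x + h) = f x + f' x * h + f'' x / 2 * h\<^sup>2 + \<eta> h * h\<^sup>2"
proof -
  define \<eta> where "\<eta> = (\<lambda>h. if h = 0 then 0 else (f (x + h) - f x - f' x * h - f'' x / 2 * h\<^sup>2) / h\<^sup>2)"
  have "\<eta> \<midarrow>0\<rightarrow> 0"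
    unfolding LIM_eq
  proof (intro allI impI)
    fix r :: real assume "0 < r"
    then obtain s where s: "0 < s" "\<And>y. \<bar>y - x\<bar> < s \<Longrightarrow> \<bar>f'' y - f'' x\<bar> < r"
      using cont unfolding continuous_at_eps_delta dist_real_def by meson
    show "\<exists>s>0. \<forall>h. h \<noteq> 0 \<and> norm (h - 0) < s \<longrightarrow> norm (\<eta> h - 0) < r"
    proof (intro exI[of _ "min e s / 2"] conjI allI impI)
      fix h :: real assume "h \<noteq> 0 \<and> norm (h - 0) < min e s / 2"
      hence h: "h \<noteq> 0" "\<bar>h\<bar> < e / 2" "\<bar>h\<bar> < s" using s(1) \<open>0 < e\<close> by auto
      define diff where "diff = (\<lambda>m::nat. if m = 0 then f else if m = 1 then f' else f'')"
      have "\<exists>t. (if x + h < x then x + h < t \<and> t < x else x < t \<and> t < x + h) \<and>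
        f (x + h) = (\<Sum>m<2. diff m x / fact m * (x + h - x) ^ m) + diff 2 t / fact 2 * (x + h - x) ^ 2"
      proof (rule Taylor[where a = "x - e / 2" and b = "x + e / 2"])
        show "\<forall>m t. m < 2 \<and> x - e / 2 \<le> t \<and> t \<le> x + e / 2 \<longrightarrow> DERIV (diff m) t :> diff (Suc m) t"
          using f' f'' \<open>0 < e\<close> by (auto simp: diff_def abs_if less_2_cases_iff)
      qed (use h in \<open>auto simp: diff_def\<close>)
      then obtain t where t: "if x + h < x then x + h < t \<and> t < x else x < t \<and> t < x + h"
        and eq: "f (x + h) = f x + f' x * h + f'' t / 2 * h\<^sup>2"
        by (auto simp: diff_def numeral_2_eq_2)
      have "\<bar>t - x\<bar> < s" using t h by (auto split: if_splits)
      hence "\<bar>f'' t - f'' x\<bar> < r" by (rule s(2))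
      moreover have "\<eta> h = (f'' t - f'' x) / 2"
      proof -
        have "f (x + h) - f x - f' x * h - f'' x / 2 * h\<^sup>2 = (f'' t - f'' x) / 2 * h\<^sup>2"
          unfolding eq by (simp add: algebra_simps diff_divide_distrib)
        thus ?thesis using h(1) by (simp add: \<eta>_def)
      qed
      ultimately show "norm (\<eta> h - 0) < r" using \<open>0 < r\<close> by (auto simp: abs_if split: if_splits)
    qed (use s \<open>0 < e\<close> in auto)
  qed
  moreover have "f (x + h) = f x + f' x * h + f'' x / 2 * h\<^sup>2 + \<eta> h * h\<^sup>2" for h
    by (simp add: \<eta>_def)
  ultimately show ?thesis using that[of \<eta>] by (simp add: \<eta>_def)
qed

section \<open>Quadratic expansions\<close>

abbreviation zero_sum :: "(real^'n) set" where
  "zero_sum \<equiv> {v. (\<Sum>i\<in>UNIV. v $ i) = 0}"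

text \<open>
  This says \<open>f v = c + q |v|\<^sup>2 + o(|v|\<^sup>2)\<close> for zero-sum \<open>v\<close> tending to 0. There is no linear term: by
  symmetry none occurs on the zero-sum hyperplane, and leaving it out makes such expansions
  multiply like dual numbers \<open>c + q \<epsilon>\<close>.
\<close>

definition quadratic_expansion :: "(real^'n \<Rightarrow> real) \<Rightarrow> real \<Rightarrow> real \<Rightarrow> bool" where
  "quadratic_expansion f c q \<longleftrightarrow> ((\<lambda>v. (f v - c) / (norm v)\<^sup>2) \<longlongrightarrow> q) (at 0 within zero_sum)"

lemma norm_tendsto_0: "((\<lambda>v::real^'n. norm v) \<longlongrightarrow> 0) (at 0 within zero_sum)"
  by (intro tendsto_eq_intros) auto

lemma quadratic_expansion_const: "quadratic_expansion (\<lambda>_. c) c 0"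
  by (simp add: quadratic_expansion_def)

lemma quadratic_expansion_norm_square: "quadratic_expansion (\<lambda>v::real^'n. (norm v)\<^sup>2) 0 1"
proof -
  have "\<forall>\<^sub>F v::real^'n in at 0 within zero_sum. 1 = ((norm v)\<^sup>2 - 0) / (norm v)\<^sup>2"
    by (auto simp: eventually_at_filter)
  thus ?thesis
    unfolding quadratic_expansion_def by (rule Lim_transform_eventually[OF tendsto_const])
qed

lemma quadratic_expansion_add:
  assumes "quadratic_expansion f c q" "quadratic_expansion g c' q'"
  shows "quadratic_expansion (\<lambda>v. f v + g v) (c + c') (q + q')"
  using tendsto_add[OF assms[unfolded quadratic_expansion_def]]
  by (simp add: quadratic_expansion_def add_divide_distrib[symmetric] algebra_simps)

lemma quadratic_expansion_sum:
  assumes "\<And>k. k \<in> K \<Longrightarrow> quadratic_expansion (f k) (c k) (q k)"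
  shows "quadratic_expansion (\<lambda>v. \<Sum>k\<in>K. f k v) (\<Sum>k\<in>K. c k) (\<Sum>k\<in>K. q k)"
  using assms by (induction K rule: infinite_finite_induct) (auto intro: quadratic_expansion_add quadratic_expansion_const)

lemma quadratic_expansion_tendsto:
  assumes "quadratic_expansion f c q"
  shows "(f \<longlongrightarrow> c) (at 0 within zero_sum)"
proof -
  have "((\<lambda>v. (f v - c) / (norm v)\<^sup>2 * (norm v)\<^sup>2 + c) \<longlongrightarrow> q * 0\<^sup>2 + c) (at 0 within zero_sum)"
    using assms unfolding quadratic_expansion_def by (intro tendsto_intros norm_tendsto_0)
  moreover have "\<forall>\<^sub>F v in at 0 within zero_sum. (f v - c) / (norm v)\<^sup>2 * (norm v)\<^sup>2 + c = f v"
    by (auto simp: eventually_at_filter)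
  ultimately show ?thesis
    by (simp add: Lim_transform_eventually)
qed

lemma quadratic_expansion_mult:
  assumes "quadratic_expansion f c q" "quadratic_expansion g c' q'"
  shows "quadratic_expansion (\<lambda>v. f v * g v) (c * c') (q * c' + c * q')"
proof -
  have "((\<lambda>v. (f v - c) / (norm v)\<^sup>2 * g v + c * ((g v - c') / (norm v)\<^sup>2)) \<longlongrightarrow> q * c' + c * q')
      (at 0 within zero_sum)"
    using assms quadratic_expansion_tendsto[OF assms(2)] unfolding quadratic_expansion_def by (intro tendsto_intros)
  moreover have "(f v - c) / r * g v + c * ((g v - c') / r) = (f v * g v - c * c') / r" for v r
    by (simp add: diff_divide_distrib algebra_simps)
  ultimately show ?thesis by (simp add: quadratic_expansion_def)
qed

text \<open>
  By Caratheodory's form of the derivative, the difference quotient of \<open>g \<circ> f\<close> is that of \<open>f\<close> times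
  a factor tending to \<open>g'\<close>.
\<close>

lemma quadratic_expansion_compose:
  assumes f: "quadratic_expansion f c q" and g: "(g has_field_derivative g') (at c)"
  shows "quadratic_expansion (\<lambda>v. g (f v)) (g c) (g' * q)"
proof -
  obtain k where k: "\<And>z. g z - g c = k z * (z - c)" "isCont k c" "k c = g'"
    using g unfolding CARAT_DERIV by metis
  have "((\<lambda>v. k (f v)) \<longlongrightarrow> g') (at 0 within zero_sum)"
    using isCont_tendsto_compose[OF k(2) quadratic_expansion_tendsto[OF f]] by (simp add: k(3))
  hence "((\<lambda>v. k (f v) * ((f v - c) / (norm v)\<^sup>2)) \<longlongrightarrow> g' * q) (at 0 within zero_sum)"
    using f unfolding quadratic_expansion_def by (intro tendsto_intros)
  thus ?thesis by (simp add: quadratic_expansion_def k(1))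
qed

lemma quadratic_expansion_remainder:
  fixes h :: "real^'n \<Rightarrow> real"
  assumes \<eta>: "\<eta> \<midarrow>0\<rightarrow> 0" "\<eta> 0 = 0" and h: "\<And>v. \<bar>h v\<bar> \<le> K * norm v"
  shows "quadratic_expansion (\<lambda>v. \<eta> (h v) * (h v)\<^sup>2) 0 0"
proof -
  have "((\<lambda>v. K * norm v) \<longlongrightarrow> K * 0) (at 0 within zero_sum)"
    by (intro tendsto_intros norm_tendsto_0)
  hence h0: "(h \<longlongrightarrow> 0) (at 0 within zero_sum)"
    by (intro Lim_null_comparison[of h "\<lambda>v. K * norm v"]) (use h in auto)
  have "isCont \<eta> 0" using \<eta> by (simp add: isCont_def)
  hence "((\<lambda>v. \<eta> (h v)) \<longlongrightarrow> 0) (at 0 within zero_sum)"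
    using isCont_tendsto_compose[OF _ h0, of \<eta>] \<eta>(2) by simp
  hence lim: "((\<lambda>v. \<bar>\<eta> (h v)\<bar> * K\<^sup>2) \<longlongrightarrow> 0) (at 0 within zero_sum)"
    using tendsto_mult_left_zero tendsto_rabs_zero by blast
  have "norm ((\<eta> (h v) * (h v)\<^sup>2 - 0) / (norm v)\<^sup>2) \<le> \<bar>\<eta> (h v)\<bar> * K\<^sup>2" for v
  proof (cases "v = 0")
    case False
    have "(h v)\<^sup>2 \<le> (K * norm v)\<^sup>2"
      using h[of v] by (metis abs_ge_zero order_trans power2_abs power_mono)
    hence "(h v)\<^sup>2 / (norm v)\<^sup>2 \<le> K\<^sup>2"
      using False by (simp add: power_mult_distrib divide_le_eq)
    hence "\<bar>\<eta> (h v)\<bar> * ((h v)\<^sup>2 / (norm v)\<^sup>2) \<le> \<bar>\<eta> (h v)\<bar> * K\<^sup>2"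
      by (rule mult_left_mono) simp
    thus ?thesis by (simp add: abs_mult)
  qed simp
  thus ?thesis
    unfolding quadratic_expansion_def by (intro Lim_null_comparison[OF _ lim]) auto
qed

lemma norm_square_vec: "(norm (v :: real^'n))\<^sup>2 = (\<Sum>i\<in>UNIV. (v $ i)\<^sup>2)"
  by (simp add: norm_vec_def L2_set_def sum_nonneg)

lemma quadratic_expansion_cong:
  fixes f g :: "real^'n \<Rightarrow> real"
  assumes "quadratic_expansion f c q" "\<forall>\<^sub>F v in at 0 within zero_sum. f v = g v"
  shows "quadratic_expansion g c q"
  using assms(1) unfolding quadratic_expansion_def
  by (rule Lim_transform_eventually) (use assms(2) in \<open>auto elim: eventually_mono\<close>)

text \<open>
  Take logarithms: \<open>ln (1 + x) = x - x\<^sup>2 / 2 + o(x\<^sup>2)\<close>, and the linear terms add up to zero.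
\<close>

lemma quadratic_expansion_inverse_prod:
  "quadratic_expansion (\<lambda>v::real^'n. inverse (\<Prod>i\<in>UNIV. 1 + v $ i)) 1 (1/2)"
proof -
  obtain \<eta> :: "real \<Rightarrow> real" where \<eta>: "\<eta> \<midarrow>0\<rightarrow> 0" "\<eta> 0 = 0"
    "\<And>h. ln (1 + h) = ln 1 + 1 / 1 * h + (- 1 / 1\<^sup>2) / 2 * h\<^sup>2 + \<eta> h * h\<^sup>2"
  proof (rule second_order_Taylor[of 1 1 ln "\<lambda>y. 1 / y" "\<lambda>y. - 1 / y\<^sup>2"])
    fix y :: real assume "\<bar>y - 1\<bar> < 1"
    hence "y > 0" by linarith
    thus "(ln has_field_derivative 1 / y) (at y)"
      by (auto intro!: derivative_eq_intros simp: inverse_eq_divide)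
    show "((\<lambda>y. 1 / y) has_field_derivative - 1 / y\<^sup>2) (at y)"
      using \<open>y > 0\<close> by (auto intro!: derivative_eq_intros simp: power2_eq_square)
  next
    show "isCont (\<lambda>y. - 1 / y\<^sup>2) (1::real)" by (intro continuous_intros) auto
  qed auto
  have "quadratic_expansion (\<lambda>v::real^'n. (- 1/2) * (norm v)\<^sup>2 + (\<Sum>i\<in>UNIV. \<eta> (v $ i) * (v $ i)\<^sup>2))
      ((- 1/2) * 0 + (\<Sum>i\<in>(UNIV::'n set). 0)) ((0 * 0 + (- 1/2) * 1) + (\<Sum>i\<in>(UNIV::'n set). 0))"
    by (intro quadratic_expansion_add quadratic_expansion_mult quadratic_expansion_const quadratic_expansion_norm_square quadratic_expansion_sum
          quadratic_expansion_remainder[OF \<eta>(1,2), of _ 1])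
       (simp add: component_le_norm_cart)
  hence log: "quadratic_expansion (\<lambda>v::real^'n. (- 1/2) * (norm v)\<^sup>2 + (\<Sum>i\<in>UNIV. \<eta> (v $ i) * (v $ i)\<^sup>2)) 0 (- 1/2)"
    by simp
  have "((\<lambda>x. exp (- x)) has_field_derivative - 1) (at (0::real))"
    by (auto intro!: derivative_eq_intros)
  from quadratic_expansion_compose[OF log this]
  have "quadratic_expansion (\<lambda>v::real^'n. exp (- ((- 1/2) * (norm v)\<^sup>2 + (\<Sum>i\<in>UNIV. \<eta> (v $ i) * (v $ i)\<^sup>2)))) 1 (1/2)"
    by simp
  moreover have "\<forall>\<^sub>F v::real^'n in at 0 within zero_sum.
      exp (- ((- 1/2) * (norm v)\<^sup>2 + (\<Sum>i\<in>UNIV. \<eta> (v $ i) * (v $ i)\<^sup>2))) = inverse (\<Prod>i\<in>UNIV. 1 + v $ i)"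
    unfolding eventually_at
  proof (intro exI[of _ 1] conjI ballI impI)
    fix v :: "real^'n" assume v: "v \<in> zero_sum" "v \<noteq> 0 \<and> dist v 0 < 1"
    have "norm v < 1" using v(2) by simp
    hence pos: "1 + v $ i > 0" for i
      using component_le_norm_cart[of v i] by linarith
    have "(\<Sum>i\<in>UNIV. ln (1 + v $ i)) = (\<Sum>i\<in>UNIV. v $ i + (- 1/2) * (v $ i)\<^sup>2 + \<eta> (v $ i) * (v $ i)\<^sup>2)"
      by (intro sum.cong refl) (simp add: \<eta>(3))
    also have "\<dots> = (- 1/2) * (norm v)\<^sup>2 + (\<Sum>i\<in>UNIV. \<eta> (v $ i) * (v $ i)\<^sup>2)"
      using v(1) unfolding sum.distrib sum_distrib_left[symmetric] norm_square_vec by simp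
    finally have "exp (- ((- 1/2) * (norm v)\<^sup>2 + (\<Sum>i\<in>UNIV. \<eta> (v $ i) * (v $ i)\<^sup>2)))
        = inverse (exp (\<Sum>i\<in>UNIV. ln (1 + v $ i)))"
      by (simp only: exp_minus)
    also have "exp (\<Sum>i\<in>UNIV. ln (1 + v $ i)) = (\<Prod>i\<in>UNIV. 1 + v $ i)"
      using pos by (simp add: exp_sum)
    finally show "exp (- ((- 1/2) * (norm v)\<^sup>2 + (\<Sum>i\<in>UNIV. \<eta> (v $ i) * (v $ i)\<^sup>2)))
        = inverse (\<Prod>i\<in>UNIV. 1 + v $ i)" .
  qed simp
  ultimately show ?thesis by (rule quadratic_expansion_cong)
qed

lemma sqrt_add_square_le: "0 \<le> a \<Longrightarrow> 0 \<le> r \<Longrightarrow> \<bar>sqrt (a + r\<^sup>2) - sqrt a\<bar> \<le> r"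
  using sqrt_add_le_add_sqrt[of a "r\<^sup>2"] real_sqrt_le_mono[of a "a + r\<^sup>2"] by simp

lemma quadratic_expansion_sqrt:
  assumes "0 < a"
  shows "quadratic_expansion (\<lambda>v::real^'n. sqrt (a + (norm v)\<^sup>2)) (sqrt a) (1 / (2 * sqrt a))"
proof -
  have "quadratic_expansion (\<lambda>v::real^'n. a + (norm v)\<^sup>2) (a + 0) (0 + 1)"
    by (intro quadratic_expansion_add quadratic_expansion_const quadratic_expansion_norm_square)
  hence f: "quadratic_expansion (\<lambda>v::real^'n. a + (norm v)\<^sup>2) a 1" by simp
  have "(sqrt has_field_derivative 1 / (2 * sqrt a)) (at a)"
    using DERIV_real_sqrt[OF assms] by (simp add: inverse_eq_divide mult.commute)
  from quadratic_expansion_compose[OF f this] show ?thesis by simp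
qed


lemma pos_power_Taylor:
  assumes "3 \<le> n"
  shows "\<exists>\<eta>. \<eta> \<midarrow>0\<rightarrow> 0 \<and> \<eta> 0 = 0 \<and> (\<forall>h. pos_power n (x + h) = pos_power n x
     + real n * pos_power (n - 1) x * h + real n * (real n - 1) / 2 * pos_power (n - 2) x * h\<^sup>2 + \<eta> h * h\<^sup>2)"
proof -
  obtain m where n: "n = Suc (Suc m)" "0 < m"
    using assms by (metis Suc_le_D Suc_le_mono numeral_3_eq_3 zero_less_Suc)
  have "isCont (\<lambda>y. real n * (real n - 1) * pos_power m y) x"
    using continuous_on_pos_power[OF n(2), of UNIV]
    by (intro continuous_intros) (auto simp: continuous_on_eq_continuous_at)
  moreover have "(pos_power n has_field_derivative real n * pos_power (n - 1) y) (at y)" for y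
    using has_field_derivative_pos_power[of y "Suc m"] by (simp add: n)
  moreover have "((\<lambda>y. real n * pos_power (n - 1) y) has_field_derivative real n * (real n - 1) * pos_power m y) (at y)" for y
    using DERIV_cmult[OF has_field_derivative_pos_power[of y m], of "real n"] n by (simp add: mult.assoc)
  ultimately obtain \<eta> where "\<eta> \<midarrow>0\<rightarrow> 0" "\<eta> 0 = 0" "\<And>h. pos_power n (x + h) = pos_power n x
      + real n * pos_power (n - 1) x * h + real n * (real n - 1) * pos_power m x / 2 * h\<^sup>2 + \<eta> h * h\<^sup>2"
    using second_order_Taylor[of 1 x "pos_power n" "\<lambda>y. real n * pos_power (n - 1) y"
        "\<lambda>y. real n * (real n - 1) * pos_power m y"] by auto
  thus ?thesis using n by (intro exI[of _ \<eta>]) simp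
qed

lemma sum_component_le_norm:
  fixes v :: "real^'n"
  shows "\<bar>\<Sum>j\<in>I. v $ j\<bar> \<le> real CARD('n) * norm v"
proof -
  have "\<bar>\<Sum>j\<in>I. v $ j\<bar> \<le> (\<Sum>j\<in>I. \<bar>v $ j\<bar>)" by (rule sum_abs)
  also have "\<dots> \<le> (\<Sum>j\<in>UNIV. \<bar>v $ j\<bar>)" by (intro sum_mono2) auto
  also have "\<dots> \<le> (\<Sum>j\<in>(UNIV::'n set). norm v)" by (intro sum_mono component_le_norm_cart)
  finally show ?thesis by simp
qed

text \<open>
  Here \<open>n = d - 1\<close> in the application. The argument of the truncated power differs from
  \<open>z - card I\<close> by \<open>\<theta> v - (\<Sum>j\<in>I. v $ j)\<close>, where \<open>\<theta> v\<close> is already of second order. So \<open>\<theta>\<close> matters only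
  through the first derivative of the truncated power and the sums over \<open>I\<close> only through the
  second.
\<close>

lemma quadratic_expansion_alternating_sum:
  fixes t z :: real and n :: nat
  assumes n: "3 \<le> n" and d: "d = CARD('n)" "2 \<le> d"
  defines "\<theta> \<equiv> \<lambda>v::real^'n. - t * (sqrt (real d + (norm v)\<^sup>2) - sqrt (real d))"
  shows "quadratic_expansion (\<lambda>v. \<Sum>I\<in>Pow UNIV. (-1) ^ card I * pos_power n (z - real (card I) + (\<theta> v - (\<Sum>j\<in>I. v $ j))))
     (\<Sum>i\<le>d. real (d choose i) * ((-1) ^ i * pos_power n (z - real i)))
     ((- t / (2 * sqrt (real d))) * (\<Sum>i\<le>d. real (d choose i) * ((-1) ^ i * (real n * pos_power (n - 1) (z - real i))))
      + (\<Sum>i\<le>d. real (d choose i) * (real i * (real d - real i) / (real d * (real d - 1))) *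
           ((-1) ^ i * (real n * (real n - 1) / 2 * pos_power (n - 2) (z - real i)))))"
proof -
  define P0 where "P0 = (\<lambda>i. (-1) ^ i * pos_power n (z - real i))"
  define P1 where "P1 = (\<lambda>i. (-1) ^ i * (real n * pos_power (n - 1) (z - real i)))"
  define P2 where "P2 = (\<lambda>i. (-1) ^ i * (real n * (real n - 1) / 2 * pos_power (n - 2) (z - real i)))"
  define w where "w = (\<lambda>I (v::real^'n). \<Sum>j\<in>I. v $ j)"
  have "\<forall>x. \<exists>\<eta>. \<eta> \<midarrow>0\<rightarrow> 0 \<and> \<eta> 0 = 0 \<and> (\<forall>h. pos_power n (x + h) = pos_power n x
     + real n * pos_power (n - 1) x * h + real n * (real n - 1) / 2 * pos_power (n - 2) x * h\<^sup>2 + \<eta> h * h\<^sup>2)"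
    using pos_power_Taylor[OF n] by blast
  then obtain \<eta> :: "real \<Rightarrow> real \<Rightarrow> real" where \<eta>: "\<And>x. \<eta> x \<midarrow>0\<rightarrow> 0" "\<And>x. \<eta> x 0 = 0"
    "\<And>x h. pos_power n (x + h) = pos_power n x
     + real n * pos_power (n - 1) x * h + real n * (real n - 1) / 2 * pos_power (n - 2) x * h\<^sup>2 + \<eta> x h * h\<^sup>2"
    unfolding choice_iff by blast
  define R where "R = (\<lambda>I v. \<eta> (z - real (card I)) (\<theta> v - w I v) * (\<theta> v - w I v)\<^sup>2)"
  have "quadratic_expansion \<theta> (- t * (sqrt (real d) + - sqrt (real d))) (0 * (sqrt (real d) + - sqrt (real d)) + - t * (1 / (2 * sqrt (real d)) + 0))"
    unfolding \<theta>_def diff_conv_add_uminus using d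
    by (intro quadratic_expansion_mult quadratic_expansion_add quadratic_expansion_const quadratic_expansion_sqrt) auto
  hence \<theta>: "quadratic_expansion \<theta> 0 (- t / (2 * sqrt (real d)))" by simp
  have bound: "\<bar>\<theta> v - w I v\<bar> \<le> (\<bar>t\<bar> + real d) * norm v" for I v
  proof -
    have "\<bar>\<theta> v\<bar> \<le> \<bar>t\<bar> * norm v"
      using sqrt_add_square_le[of "real d" "norm v"] by (simp add: \<theta>_def abs_mult mult_left_mono)
    moreover have "\<bar>w I v\<bar> \<le> real d * norm v"
      unfolding w_def d by (rule sum_component_le_norm)
    ultimately show ?thesis by (simp add: algebra_simps)
  qed
  have R: "quadratic_expansion (\<lambda>v. R I v) 0 0" for I
    unfolding R_def using bound by (intro quadratic_expansion_remainder[OF \<eta>(1,2)])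
  define M0 where "M0 = (\<Sum>i\<le>d. real (d choose i) * P0 i)"
  define M1 where "M1 = (\<Sum>i\<le>d. real (d choose i) * P1 i)"
  define M2 where "M2 = (\<Sum>i\<le>d. real (d choose i) * P2 i)"
  define N2 where "N2 = (\<Sum>i\<le>d. real (d choose i) * (real i * (real d - real i) / (real d * (real d - 1))) * P2 i)"
  have "quadratic_expansion (\<lambda>v. M0 + M1 * \<theta> v + M2 * (\<theta> v * \<theta> v) + N2 * (norm v)\<^sup>2 + (\<Sum>I\<in>Pow UNIV. (-1) ^ card I * R I v))
     (M0 + M1 * 0 + M2 * (0 * 0) + N2 * 0 + (\<Sum>I\<in>Pow (UNIV::'n set). (-1) ^ card I * 0))
     (0 + (0 * 0 + M1 * (- t / (2 * sqrt (real d)))) + (0 * (0 * 0) + M2 * ((- t / (2 * sqrt (real d))) * 0 + 0 * (- t / (2 * sqrt (real d)))))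
       + (0 * 0 + N2 * 1) + (\<Sum>I\<in>Pow (UNIV::'n set). 0 * 0 + (-1) ^ card I * 0))"
    by (intro quadratic_expansion_add quadratic_expansion_mult quadratic_expansion_const quadratic_expansion_norm_square quadratic_expansion_sum \<theta> R)
  hence "quadratic_expansion (\<lambda>v. M0 + M1 * \<theta> v + M2 * (\<theta> v * \<theta> v) + N2 * (norm v)\<^sup>2 + (\<Sum>I\<in>Pow UNIV. (-1) ^ card I * R I v))
     M0 ((- t / (2 * sqrt (real d))) * M1 + N2)"
    by (simp add: mult.commute)
  moreover have "\<forall>\<^sub>F v in at 0 within zero_sum.
     M0 + M1 * \<theta> v + M2 * (\<theta> v * \<theta> v) + N2 * (norm v)\<^sup>2 + (\<Sum>I\<in>Pow UNIV. (-1) ^ card I * R I v)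
     = (\<Sum>I\<in>Pow UNIV. (-1) ^ card I * pos_power n (z - real (card I) + (\<theta> v - (\<Sum>j\<in>I. v $ j))))"
    unfolding eventually_at
  proof (intro exI[of _ 1] conjI ballI impI)
    fix v :: "real^'n" assume "v \<in> zero_sum"
    hence v: "(\<Sum>j\<in>UNIV. v $ j) = 0" by simp
    have expand: "s * (p0 + p1 * (x - y) + p2 * (x - y)\<^sup>2 + e * (x - y)\<^sup>2)
        = s * p0 + x * (s * p1) + (x * x) * (s * p2) + s * (e * (x - y)\<^sup>2)
          - s * p1 * y - 2 * x * (s * p2 * y) + s * p2 * y\<^sup>2" for s p0 p1 p2 e x y :: real
      by (simp add: power2_eq_square algebra_simps)
    have "(\<Sum>I\<in>Pow UNIV. (-1) ^ card I * pos_power n (z - real (card I) + (\<theta> v - w I v)))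
       = (\<Sum>I\<in>Pow UNIV. P0 (card I) + \<theta> v * P1 (card I) + (\<theta> v * \<theta> v) * P2 (card I) + (-1) ^ card I * R I v
            - P1 (card I) * w I v - 2 * \<theta> v * (P2 (card I) * w I v) + P2 (card I) * (w I v)\<^sup>2)"
      unfolding \<eta>(3) P0_def P1_def P2_def R_def by (intro sum.cong refl expand)
    also have "\<dots> = M0 + \<theta> v * M1 + (\<theta> v * \<theta> v) * M2 + (\<Sum>I\<in>Pow UNIV. (-1) ^ card I * R I v)
        - 0 - 2 * \<theta> v * 0 + (norm v)\<^sup>2 * N2"
      unfolding sum.distrib sum_subtractf sum_distrib_left[symmetric] w_def
        sum_Pow_card_linear[OF finite v] sum_Pow_card_quadratic[OF finite v] norm_square_vec[symmetric]
        d(1)[symmetric] sum_binomial_shift2[OF d(2)]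
      using sum_Pow_card[of "UNIV :: 'n set"]
      by (simp add: M0_def M1_def M2_def N2_def d(1)[symmetric])
    finally show "M0 + M1 * \<theta> v + M2 * (\<theta> v * \<theta> v) + N2 * (norm v)\<^sup>2 + (\<Sum>I\<in>Pow UNIV. (-1) ^ card I * R I v)
     = (\<Sum>I\<in>Pow UNIV. (-1) ^ card I * pos_power n (z - real (card I) + (\<theta> v - (\<Sum>j\<in>I. v $ j))))"
      by (simp add: w_def algebra_simps)
  qed simp
  ultimately have "quadratic_expansion (\<lambda>v. \<Sum>I\<in>Pow UNIV. (-1) ^ card I * pos_power n (z - real (card I) + (\<theta> v - (\<Sum>j\<in>I. v $ j))))
     M0 ((- t / (2 * sqrt (real d))) * M1 + N2)"
    by (rule quadratic_expansion_cong)
  thus ?thesis by (simp only: M0_def M1_def N2_def P0_def P1_def P2_def)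
qed

section \<open>The section volume near a diagonal direction\<close>

lemma pos_power_scale: "0 < m \<Longrightarrow> pos_power n (m * x) = m ^ n * pos_power n x"
  by (simp add: pos_power_def power_mult_distrib zero_le_mult_iff)

lemma pos_power_Suc: "pos_power (Suc n) x = x * pos_power n x"
  by (simp add: pos_power_def)

lemma S_sum_eq_pos_power:
  "S_sum d z = (\<Sum>i\<le>d. (-1) ^ i * real (d choose i) * pos_power (d - 3) (z - real i) * p_quad i d z)"
proof -
  define A where "A = {i::nat. int i \<le> \<lfloor>z\<rfloor>}"
  define g where "g = (\<lambda>i. (-1) ^ i * real (d choose i) * pos_power (d - 3) (z - real i) * p_quad i d z)"
  have A: "i \<in> A \<longleftrightarrow> real i \<le> z" for i by (simp add: A_def le_floor_iff)
  have "finite A"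
    by (rule finite_subset[of _ "{..nat \<lfloor>z\<rfloor>}"]) (auto simp: A_def)
  have "S_sum d z = sum g A"
    unfolding S_sum_def A_def[symmetric] using A by (intro sum.cong) (auto simp: g_def pos_power_def)
  also have "\<dots> = sum g (A \<inter> {..d})"
    using \<open>finite A\<close> by (intro sum.mono_neutral_right) (auto simp: g_def)
  also have "\<dots> = sum g {..d}"
    using A by (intro sum.mono_neutral_left) (auto simp: g_def pos_power_def)
  finally show ?thesis by (simp add: g_def)
qed

text \<open>
  The section volume as a function of the relative deviations \<open>v\<close> of the numbers \<open>|a\<^sub>i|\<close> from their
  mean. The level is written as \<open>z\<close>, its value at \<open>v = 0\<close>, plus the change
  \<open>- t * (sqrt (d + |v|\<^sup>2) - sqrt d)\<close>, in order to have a fixed centre for the Taylor expansion.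
\<close>

definition section_profile :: "real \<Rightarrow> real^'n \<Rightarrow> real" where
  "section_profile t v =
     sqrt (real CARD('n) + (norm v)\<^sup>2) * inverse (\<Prod>i\<in>UNIV. 1 + v $ i)
     * (\<Sum>I\<in>Pow UNIV. (-1) ^ card I * pos_power (CARD('n) - 1)
          (real CARD('n) / 2 - t * sqrt (real CARD('n)) - real (card I)
            + (- t * (sqrt (real CARD('n) + (norm v)\<^sup>2) - sqrt (real CARD('n))) - (\<Sum>j\<in>I. v $ j))))
     / fact (CARD('n) - 1)"

text \<open>
  At \<open>b = 0\<close> the mean vanishes and all components take the default value \<open>-1\<close>, so that
  \<open>sum_relative_deviation\<close> excludes this vector.
\<close>

definition relative_deviation :: "real^'n \<Rightarrow> real^'n" where
  "relative_deviation b = (\<chi> i. \<bar>b $ i\<bar> / ((\<Sum>j\<in>UNIV. \<bar>b $ j\<bar>) / real CARD('n)) - 1)"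

lemma sum_relative_deviation:
  fixes b :: "real^'n"
  assumes "b \<noteq> 0"
  shows "(\<Sum>i\<in>UNIV. relative_deviation b $ i) = 0"
proof -
  obtain i where "b $ i \<noteq> 0" using assms by (auto simp: vec_eq_iff)
  hence "(\<Sum>j\<in>UNIV. \<bar>b $ j\<bar>) > 0" by (intro sum_pos2[of _ i]) auto
  thus ?thesis
    by (simp add: relative_deviation_def sum_subtractf sum_divide_distrib[symmetric] sum_distrib_right[symmetric])
qed

text \<open>
  Put \<open>|b\<^sub>i| = m (1 + v\<^sub>i)\<close>. The factor \<open>m\<close> pulls out of each truncated power as \<open>m ^ (d - 1)\<close> and out
  of the product in the denominator as \<open>m ^ d\<close>; the remaining \<open>1/m\<close> is \<open>sqrt (d + |v|\<^sup>2)\<close> by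
  \<open>norm b = 1\<close>.
\<close>

lemma section_volume_eq_profile:
  fixes b :: "real^'n"
  assumes b: "norm b = 1" and nz: "\<And>i. b $ i \<noteq> 0" and dim: "2 \<le> CARD('n)"
  shows "section_volume t b = section_profile t (relative_deviation b)"
proof -
  define d where "d = CARD('n)"
  define m where "m = (\<Sum>j\<in>UNIV. \<bar>b $ j\<bar>) / real d"
  define v where "v = relative_deviation b"
  have "0 < (\<Sum>j\<in>UNIV. \<bar>b $ j\<bar>)" using nz by (intro sum_pos) auto
  hence m: "0 < m" using dim by (simp add: m_def d_def)
  have bv: "\<bar>b $ i\<bar> = m * (1 + v $ i)" for i
    using m by (simp add: v_def relative_deviation_def m_def[symmetric] d_def[symmetric])
  have "b \<noteq> 0" using b by auto
  hence v0: "(\<Sum>i\<in>UNIV. v $ i) = 0" unfolding v_def by (rule sum_relative_deviation)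
  have "1 = (\<Sum>i\<in>UNIV. \<bar>b $ i\<bar>\<^sup>2)"
    using b norm_square_vec[of b] by simp
  also have "\<dots> = m\<^sup>2 * (\<Sum>i\<in>UNIV. 1 + 2 * v $ i + (v $ i)\<^sup>2)"
    unfolding bv sum_distrib_left by (intro sum.cong refl) (simp add: power2_eq_square algebra_simps)
  also have "(\<Sum>i\<in>UNIV. 1 + 2 * v $ i + (v $ i)\<^sup>2) = real d + (norm v)\<^sup>2"
    by (simp add: sum.distrib sum_distrib_left[symmetric] v0 norm_square_vec d_def)
  finally have "real d + (norm v)\<^sup>2 = (1 / m)\<^sup>2" using m by (simp add: field_simps)
  hence root: "sqrt (real d + (norm v)\<^sup>2) = 1 / m" using m by simp
  define C where "C = (\<Sum>I\<in>Pow UNIV. (-1) ^ card I * pos_power (d - 1)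
          (real d / 2 - t * sqrt (real d) - real (card I) + (- t * (1 / m - sqrt (real d)) - (\<Sum>j\<in>I. v $ j))))"
  have "signed_vertex_sum (($) b) UNIV (d - 1) (- t) = m ^ (d - 1) * C"
    unfolding signed_vertex_sum_def C_def sum_distrib_left
  proof (intro sum.cong refl)
    fix I :: "'n set"
    have "(\<Sum>j\<in>I. \<bar>b $ j\<bar>) = m * (real (card I) + (\<Sum>j\<in>I. v $ j))" for I :: "'n set"
      by (simp add: bv sum_distrib_left[symmetric] sum.distrib)
    hence "- t + (\<Sum>j\<in>UNIV. \<bar>b $ j\<bar>) / 2 - (\<Sum>j\<in>I. \<bar>b $ j\<bar>)
       = m * (real d / 2 - t * sqrt (real d) - real (card I) + (- t * (1 / m - sqrt (real d)) - (\<Sum>j\<in>I. v $ j)))"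
      using m by (simp add: v0 d_def algebra_simps)
    thus "(- 1) ^ card I * pos_power (d - 1) (- t + (\<Sum>j\<in>UNIV. \<bar>b $ j\<bar>) / 2 - (\<Sum>j\<in>I. \<bar>b $ j\<bar>))
      = m ^ (d - 1) * ((- 1) ^ card I * pos_power (d - 1) (real d / 2 - t * sqrt (real d) - real (card I)
          + (- t * (1 / m - sqrt (real d)) - (\<Sum>j\<in>I. v $ j))))"
      using m by (simp only: pos_power_scale mult.left_commute)
  qed
  moreover have "(\<Prod>i\<in>UNIV. \<bar>b $ i\<bar>) = m ^ (d - 1) * (m * (\<Prod>i\<in>UNIV. 1 + v $ i))"
    using dim by (simp add: bv prod.distrib d_def power_eq_if[of m "CARD('n)"])
  ultimately have "section_volume t b = m ^ (d - 1) * C / (fact (d - 1) * (m ^ (d - 1) * (m * (\<Prod>i\<in>UNIV. 1 + v $ i))))"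
    using section_volume_formula[OF b nz dim] by (simp add: d_def)
  also have "\<dots> = 1 / m * inverse (\<Prod>i\<in>UNIV. 1 + v $ i) * C / fact (d - 1)"
    using m by (simp add: divide_simps)
  also have "\<dots> = section_profile t v"
    unfolding section_profile_def d_def[symmetric] root C_def ..
  finally show ?thesis by (simp add: v_def)
qed

text \<open>
  Multiply the expansions of the three factors. That the result is a multiple of \<open>S\<close> is an
  identity between the coefficients of each \<open>(-1)^i (d choose i) (z - i)\<^sub>+^(d - 3)\<close>.
\<close>

lemma quadratic_expansion_section_profile:
  fixes t z :: real
  defines "d \<equiv> CARD('n)"
  assumes d: "4 \<le> d" and z: "z = real d / 2 - t * sqrt (real d)"
  shows "quadratic_expansion (section_profile t :: real^'n \<Rightarrow> real) (section_profile t (0 :: real^'n))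
      (sqrt (real d) * (real d - 1) * (real d - 2) / (2 * real d * fact (d - 1)) * S_sum d z)"
proof -
  define r where "r = sqrt (real d)"
  have r: "0 < r" "r * r = real d" using d by (auto simp: r_def)
  define M0 where "M0 = (\<Sum>i\<le>d. real (d choose i) * ((-1) ^ i * pos_power (d - 1) (z - real i)))"
  define M1 where "M1 = (\<Sum>i\<le>d. real (d choose i) * ((-1) ^ i * (real (d - 1) * pos_power (d - 1 - 1) (z - real i))))"
  define N2 where "N2 = (\<Sum>i\<le>d. real (d choose i) * (real i * (real d - real i) / (real d * (real d - 1))) *
           ((-1) ^ i * (real (d - 1) * (real (d - 1) - 1) / 2 * pos_power (d - 1 - 2) (z - real i))))"
  have "quadratic_expansion (\<lambda>v::real^'n. sqrt (real d + (norm v)\<^sup>2) * inverse (\<Prod>i\<in>UNIV. 1 + v $ i)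
     * (\<Sum>I\<in>Pow UNIV. (-1) ^ card I * pos_power (d - 1)
          (z - real (card I) + (- t * (sqrt (real d + (norm v)\<^sup>2) - sqrt (real d)) - (\<Sum>j\<in>I. v $ j))))
     * (1 / fact (d - 1)))
     (r * 1 * M0 * (1 / fact (d - 1)))
     (((1 / (2 * r) * 1 + r * (1/2)) * M0 + r * 1 * ((- t / (2 * r)) * M1 + N2)) * (1 / fact (d - 1)) + r * 1 * M0 * 0)"
    unfolding r_def M0_def M1_def N2_def using d
    by (intro quadratic_expansion_mult quadratic_expansion_const quadratic_expansion_sqrt quadratic_expansion_inverse_prod quadratic_expansion_alternating_sum)
       (auto simp: d_def)
  hence *: "quadratic_expansion (section_profile t :: real^'n \<Rightarrow> real) (r * M0 / fact (d - 1))
     (((1 / (2 * r) + r / 2) * M0 + r * ((- t / (2 * r)) * M1 + N2)) / fact (d - 1))"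
    by (simp add: section_profile_def[abs_def] d_def[symmetric] z[symmetric])
  have "section_profile t (0 :: real^'n) = r * M0 / fact (d - 1)"
    using sum_Pow_card[of "UNIV :: 'n set" "\<lambda>i. (-1) ^ i * pos_power (d - 1) (z - real i)"]
    by (simp add: section_profile_def d_def[symmetric] z[symmetric] r_def M0_def)
  moreover have "(1 / (2 * r) + r / 2) * M0 + r * ((- t / (2 * r)) * M1 + N2)
     = r * (real d - 1) * (real d - 2) / (2 * real d) * S_sum d z"
  proof -
    define k where "k = (\<lambda>i. (-1) ^ i * real (d choose i) * pos_power (d - 3) (z - real i))"
    have pp: "pos_power (d - 1) x = x * x * pos_power (d - 3) x" "pos_power (d - 1 - 1) x = x * pos_power (d - 3) x" for x
    proof -
      have "d - 1 = Suc (Suc (d - 3))" "d - 1 - 1 = Suc (d - 3)" using d by auto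
      thus "pos_power (d - 1) x = x * x * pos_power (d - 3) x" "pos_power (d - 1 - 1) x = x * pos_power (d - 3) x"
        by (simp_all only: pos_power_Suc mult.assoc)
    qed
    have coeff: "(1 / (2 * r) + r / 2) * (z - i)\<^sup>2 + r * ((- t / (2 * r)) * ((real d - 1) * (z - i))
        + i * (real d - i) / (real d * (real d - 1)) * ((real d - 1) * (real d - 2) / 2))
      = r * (real d - 1) * (real d - 2) / (2 * real d) *
        (i * (real d - i) / (real d - 1) - (real d / 2 - i) * ((z - i) / (real d - 2))
          + 2 * real d * (z - i)^2 / ((real d - 1) * (real d - 2)))" for i :: real
    proof -
      define e where "e = real d"
      have e: "2 < e" "r * r = e" using d r by (auto simp: e_def)
      define g where "g = r / (2 * e)"
      have g1: "1 / (2 * r) = g" using r e by (simp add: g_def field_simps)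
      have g2: "r / 2 = g * e" using e by (simp add: g_def)
      have g3: "r * (- t / (2 * r)) = - g * (e / 2 - z)"
      proof -
        have "e / 2 - z = t * r" by (simp add: z e_def r_def)
        moreover have "g * (t * r) = t / 2"
          using e by (simp add: g_def divide_simps)
        ultimately show ?thesis using r by simp
      qed
      have g4: "r * (i * (e - i) / (e * (e - 1)) * ((e - 1) * (e - 2) / 2)) = g * (i * (e - i) * (e - 2))"
        using e by (simp add: g_def divide_simps)
      have "(1 / (2 * r) + r / 2) * (z - i)\<^sup>2 + r * ((- t / (2 * r)) * ((e - 1) * (z - i))
          + i * (e - i) / (e * (e - 1)) * ((e - 1) * (e - 2) / 2))
        = (1 / (2 * r) + r / 2) * (z - i)\<^sup>2 + (r * (- t / (2 * r)) * ((e - 1) * (z - i))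
          + r * (i * (e - i) / (e * (e - 1)) * ((e - 1) * (e - 2) / 2)))"
        by (simp only: distrib_left mult.assoc)
      also have "\<dots> = g * ((1 + e) * (z - i)\<^sup>2 - (e / 2 - z) * ((e - 1) * (z - i)) + i * (e - i) * (e - 2))"
        unfolding g1 g2 g3 g4 by (simp add: algebra_simps)
      also have "(1 + e) * (z - i)\<^sup>2 - (e / 2 - z) * ((e - 1) * (z - i)) + i * (e - i) * (e - 2)
        = (e - 1) * (e - 2) * (i * (e - i) / (e - 1) - (e / 2 - i) * ((z - i) / (e - 2))
          + 2 * e * (z - i)^2 / ((e - 1) * (e - 2)))"
      proof -
        have "(e - 1) * (e - 2) * (i * (e - i) / (e - 1)) = (e - 2) * (i * (e - i))"
          "(e - 1) * (e - 2) * ((e / 2 - i) * ((z - i) / (e - 2))) = (e - 1) * ((e / 2 - i) * (z - i))"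
          "(e - 1) * (e - 2) * (2 * e * (z - i)^2 / ((e - 1) * (e - 2))) = 2 * e * (z - i)^2"
          using e by simp_all
        thus ?thesis
          unfolding distrib_left right_diff_distrib
          by (simp only:) (simp add: power2_eq_square algebra_simps)
      qed
      finally show ?thesis by (simp add: e_def g_def)
    qed
    have "(1 / (2 * r) + r / 2) * M0 + r * ((- t / (2 * r)) * M1 + N2)
       = (\<Sum>i\<le>d. k i * ((1 / (2 * r) + r / 2) * (z - real i)\<^sup>2 + r * ((- t / (2 * r)) * ((real d - 1) * (z - real i))
        + real i * (real d - real i) / (real d * (real d - 1)) * ((real d - 1) * (real d - 2) / 2))))"
    proof -
      have "M0 = (\<Sum>i\<le>d. k i * (z - real i)\<^sup>2)"
        unfolding M0_def k_def pp by (intro sum.cong refl) (simp add: power2_eq_square)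
      moreover have "M1 = (\<Sum>i\<le>d. k i * ((real d - 1) * (z - real i)))"
        unfolding M1_def k_def pp using d by (intro sum.cong refl) (simp add: of_nat_diff)
      moreover have "N2 = (\<Sum>i\<le>d. k i * (real i * (real d - real i) / (real d * (real d - 1)) * ((real d - 1) * (real d - 2) / 2)))"
      proof -
        have "d - 1 - 2 = d - 3" "real (d - 1) - 1 = real d - 2" "real (d - 1) = real d - 1" using d by (auto simp: of_nat_diff)
        thus ?thesis unfolding N2_def k_def by (intro sum.cong refl) (simp only: mult_ac)
      qed
      moreover have "p * (\<Sum>i\<le>d. k i * x i) + r * (q * (\<Sum>i\<le>d. k i * y i) + (\<Sum>i\<le>d. k i * w i))
          = (\<Sum>i\<le>d. k i * (p * x i + r * (q * y i + w i)))" for p q x y w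
        by (simp add: sum_distrib_left sum.distrib algebra_simps)
      ultimately show ?thesis by (simp only:)
    qed
    also have "\<dots> = (\<Sum>i\<le>d. r * (real d - 1) * (real d - 2) / (2 * real d) * (k i * p_quad i d z))"
      unfolding coeff p_quad_def by (intro sum.cong refl) (simp only: mult.left_commute)
    also have "\<dots> = r * (real d - 1) * (real d - 2) / (2 * real d) * S_sum d z"
      by (simp add: S_sum_eq_pos_power k_def sum_distrib_left)
    finally show ?thesis .
  qed
  ultimately show ?thesis using * by (simp add: r_def)
qed

section \<open>Local extremality\<close>

text \<open>
  A diagonal spans the multiples of a vector with entries \<open>1\<close> and \<open>-1\<close>.
\<close>

lemma cube_diagonal_direction_components:
  fixes a :: "real^'n"
  assumes D: "cube_diagonal D" and a: "a \<in> sphere 0 1 \<inter> directions D"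
  shows "\<bar>a $ i\<bar> = 1 / sqrt (real CARD('n))"
proof -
  obtain u :: "real^'n" where u: "cube_vertex u" "D = closed_segment u (1 - u)"
    using D by (auto simp: cube_diagonal_def)
  define w where "w = (1 - u) - u"
  have "{x - y |x y. x \<in> D \<and> y \<in> D} \<subseteq> span {w}"
  proof clarify
    fix x y assume "x \<in> D" "y \<in> D"
    then obtain k l where xy: "x = (1 - k) *\<^sub>R u + k *\<^sub>R (1 - u)" "y = (1 - l) *\<^sub>R u + l *\<^sub>R (1 - u)"
      unfolding u(2) in_segment by blast
    have "x - y = (k - l) *\<^sub>R w" unfolding xy w_def by (simp add: algebra_simps)
    thus "x - y \<in> span {w}" by (simp add: span_mul span_base)
  qed
  hence "directions D \<subseteq> span {w}" unfolding directions_def by (simp add: span_minimal)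
  then obtain c where c: "a = c *\<^sub>R w" using a by (auto simp: span_singleton)
  have comp: "\<bar>a $ i\<bar> = \<bar>c\<bar>" for i
  proof -
    have "u $ i = 0 \<or> u $ i = 1" using u(1) by (simp add: cube_vertex_def)
    hence "\<bar>w $ i\<bar> = 1" by (auto simp: w_def)
    thus ?thesis by (simp add: c abs_mult)
  qed
  have "1 = (\<Sum>i\<in>UNIV. \<bar>a $ i\<bar>\<^sup>2)"
    using a norm_square_vec[of a] by simp
  also have "\<dots> = real CARD('n) * \<bar>c\<bar>\<^sup>2" by (simp add: comp)
  finally have "\<bar>c\<bar>\<^sup>2 = (1 / sqrt (real CARD('n)))\<^sup>2"
    by (simp add: field_simps)
  hence "\<bar>c\<bar> = 1 / sqrt (real CARD('n))" by (rule power2_eq_imp_eq) simp_all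
  thus ?thesis by (simp add: comp)
qed

context
  fixes a :: "real^'n"
  assumes a_norm: "norm a = 1" and a_comp: "\<And>i. \<bar>a $ i\<bar> = 1 / sqrt (real CARD('n))"
begin

lemma relative_deviation_diagonal: "relative_deviation a = 0"
  by (simp add: relative_deviation_def vec_eq_iff a_comp)

lemma relative_deviation_zero_imp_same:
  assumes b: "norm b = 1" "\<And>i. b $ i * a $ i > 0" and v: "relative_deviation b = 0"
  shows "b = a"
proof -
  define m where "m = (\<Sum>j\<in>UNIV. \<bar>b $ j\<bar>) / real CARD('n)"
  have comp: "\<bar>b $ i\<bar> = m" for i
  proof -
    have "\<bar>b $ i\<bar> / m = 1"
      using v by (auto simp: relative_deviation_def vec_eq_iff m_def)
    thus ?thesis by (cases "m = 0") auto
  qed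
  have "0 \<le> m" unfolding m_def by (simp add: sum_nonneg)
  have "1 = (\<Sum>i\<in>UNIV. \<bar>b $ i\<bar>\<^sup>2)"
    using b norm_square_vec[of b] by simp
  also have "\<dots> = real CARD('n) * m\<^sup>2" by (simp add: comp)
  finally have "m\<^sup>2 = (1 / sqrt (real CARD('n)))\<^sup>2"
    by (simp add: field_simps)
  hence "m = 1 / sqrt (real CARD('n))" by (rule power2_eq_imp_eq) (simp_all add: \<open>0 \<le> m\<close>)
  hence "\<bar>b $ i\<bar> = \<bar>a $ i\<bar>" for i using comp a_comp by simp
  moreover have "b $ i * a $ i > 0" for i by fact
  ultimately have "b $ i = a $ i" for i
    by (metis abs_eq_iff less_asym mult_minus_left neg_0_less_iff_less not_square_less_zero zero_less_mult_iff)
  thus ?thesis by (simp add: vec_eq_iff)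
qed

lemma eventually_same_signs:
  "\<forall>\<^sub>F b in at a within A. \<forall>i. b $ i * a $ i > 0"
  unfolding eventually_at
proof (intro exI[of _ "1 / sqrt (real CARD('n))"] conjI ballI impI allI)
  fix b i assume "b \<noteq> a \<and> dist b a < 1 / sqrt (real CARD('n))"
  hence "\<bar>(b - a) $ i\<bar> < \<bar>a $ i\<bar>"
    using component_le_norm_cart[of "b - a" i] by (simp add: a_comp dist_norm)
  hence "b $ i > 0 \<and> a $ i > 0 \<or> b $ i < 0 \<and> a $ i < 0"
    by (simp add: abs_if split: if_splits)
  thus "b $ i * a $ i > 0" by (auto simp: zero_less_mult_iff)
qed simp

lemma filterlim_relative_deviation: "filterlim relative_deviation (at 0 within zero_sum) (at a within sphere 0 1)"
  unfolding filterlim_at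
proof (intro conjI)
  have "\<forall>\<^sub>F b in at a within sphere 0 1. b \<in> sphere 0 1 \<and> b \<noteq> a"
    by (simp add: eventually_at_filter)
  thus "\<forall>\<^sub>F b in at a within sphere 0 1. relative_deviation b \<in> zero_sum \<and> relative_deviation b \<noteq> 0"
    using eventually_same_signs[of "sphere 0 1"]
  proof eventually_elim
    case (elim b)
    hence "b \<noteq> 0" by auto
    thus ?case using elim relative_deviation_zero_imp_same[of b] by (auto simp: sum_relative_deviation)
  qed
  have "(\<Sum>j\<in>UNIV. \<bar>a $ j\<bar>) / real CARD('n) \<noteq> 0" by (simp add: a_comp)
  hence "(relative_deviation \<longlongrightarrow> relative_deviation a) (at a within sphere 0 1)"
    unfolding relative_deviation_def[abs_def] by (intro tendsto_vec_lambda tendsto_intros) auto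
  thus "(relative_deviation \<longlongrightarrow> 0) (at a within sphere 0 1)" by (simp add: relative_deviation_diagonal)
qed

lemma tendsto_section_volume_quotient:
  fixes t z :: real
  assumes d: "4 \<le> CARD('n)" and z: "z = real CARD('n) / 2 - t * sqrt (real CARD('n))"
  shows "((\<lambda>b. (section_volume t b - section_volume t a) / (norm (relative_deviation b))\<^sup>2) \<longlongrightarrow>
      sqrt (real CARD('n)) * (real CARD('n) - 1) * (real CARD('n) - 2) / (2 * real CARD('n) * fact (CARD('n) - 1))
        * S_sum CARD('n) z) (at a within sphere 0 1)" (is "(_ \<longlongrightarrow> ?q) _")
proof -
  have "a $ i \<noteq> 0" for i using a_comp[of i] by auto
  hence a: "section_volume t a = section_profile t (0 :: real^'n)"
    using section_volume_eq_profile[OF a_norm] d by (simp add: relative_deviation_diagonal)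
  have "((\<lambda>b. (section_profile t (relative_deviation b) - section_profile t (0 :: real^'n)) / (norm (relative_deviation b))\<^sup>2) \<longlongrightarrow> ?q)
      (at a within sphere 0 1)"
    using quadratic_expansion_section_profile[where 'n = 'n, OF d z] filterlim_relative_deviation unfolding quadratic_expansion_def
    by (rule filterlim_compose)
  moreover have "\<forall>\<^sub>F b in at a within sphere 0 1. b \<in> sphere 0 1"
    by (simp add: eventually_at_filter)
  hence "\<forall>\<^sub>F b in at a within sphere 0 1.
      (section_profile t (relative_deviation b) - section_profile t (0 :: real^'n)) / (norm (relative_deviation b))\<^sup>2
    = (section_volume t b - section_volume t a) / (norm (relative_deviation b))\<^sup>2"
    using eventually_same_signs[of "sphere 0 1"]
  proof eventually_elim
    case (elim b)
    have "b $ i \<noteq> 0" for i using elim(2) by (metis less_irrefl mult_zero_left)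
    thus ?case using section_volume_eq_profile[of b t] elim(1) d by (simp add: a)
  qed
  ultimately show ?thesis by (rule Lim_transform_eventually)
qed

end

theorem theorem1p4:
  fixes d :: nat and t z :: real
  assumes "d = CARD('n::finite)" and "d \<ge> 4" and "t \<ge> 0"
    and "z = real d / 2 - t * sqrt (real d)"
  shows "(S_sum d z < 0 \<longrightarrow>
            (\<forall>D :: (real^'n) set. cube_diagonal D \<longrightarrow>
              (\<forall>a \<in> sphere 0 1 \<inter> directions D.
                 strict_local_max_on (sphere 0 1) (section_volume t) a)))
       \<and> (S_sum d z > 0 \<longrightarrow>
            (\<forall>D :: (real^'n) set. cube_diagonal D \<longrightarrow>
              (\<forall>a \<in> sphere 0 1 \<inter> directions D.
                 strict_local_min_on (sphere 0 1) (section_volume t) a)))"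
proof -
  define K where "K = sqrt (real d) * (real d - 1) * (real d - 2) / (2 * real d * fact (d - 1))"
  have "K > 0" using assms(2) by (simp add: K_def)
  have lim: "((\<lambda>b. (section_volume t b - section_volume t a) / (norm (relative_deviation b))\<^sup>2) \<longlongrightarrow> K * S_sum d z)
      (at a within sphere 0 1)"
    if "cube_diagonal D" "a \<in> sphere 0 1 \<inter> directions D" for a :: "real^'n" and D
    using tendsto_section_volume_quotient[of a z t] cube_diagonal_direction_components[OF that] that(2) assms
    by (simp add: K_def)
  show ?thesis
  proof (intro conjI impI allI ballI)
    fix D :: "(real^'n) set" and a
    assume S: "S_sum d z < 0" and D: "cube_diagonal D" "a \<in> sphere 0 1 \<inter> directions D"
    have "K * S_sum d z < 0" using S \<open>K > 0\<close> by (simp add: mult_pos_neg)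
    from order_tendstoD(2)[OF lim[OF D] this] show "strict_local_max_on (sphere 0 1) (section_volume t) a"
      unfolding strict_local_max_on_def using D(2)
      by (auto elim!: eventually_mono simp: divide_less_0_iff)
  next
    fix D :: "(real^'n) set" and a
    assume S: "S_sum d z > 0" and D: "cube_diagonal D" "a \<in> sphere 0 1 \<inter> directions D"
    have "K * S_sum d z > 0" using S \<open>K > 0\<close> by simp
    from order_tendstoD(1)[OF lim[OF D] this] show "strict_local_min_on (sphere 0 1) (section_volume t) a"
      unfolding strict_local_min_on_def using D(2)
      by (auto elim!: eventually_mono simp: zero_less_divide_iff)
  qed
qed

end
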